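(* Let $u$ be a Leray–Hopf solution of the Navier–Stokes equations (unit viscosity, no force) on $\mathbb R^3$, on a time interval containing $(t_0-1,t_0)$; let $0<\sigma<1$, $\Gamma>1$, $r_k=2^{-k}$, $\ell_k=\sigma r_k$, and let $\mu_k^{\mathrm{far,ann}}$, $\mathfrak A_j$, $\mathcal Q_k$ be as defined in the context. Assume $\mathfrak A=(\mathfrak A_j)_{j\ge0}\in\ell^p$ and $\mathcal Q=(\mathcal Q_k)_{k\ge0}\in\ell^q$, where $1\le p,q\le\infty$ and $1/p+1/q=1$. Then there is a constant $C_0=C_0(\Gamma,\sigma,\chi,\varphi)$ such that, for every $N$, $$\sum_{k=0}^{N}\mu_k^{\mathrm{far,ann}}\le2\,C_0(\Gamma,\sigma,\chi,\varphi)\,\|\mathfrak A\|_{\ell^p}\,\|\mathcal Q\|_{\ell^q}.$$ In particular the right-hand side is independent of $N$. (Here $C_0$ is the same constant for which $\mu_k^{\mathrm{far,ann}}\le C_0\sum_{j=0}^k2^{-(k-j)}\mathfrak A_j\mathcal Q_k$ for all $k$.)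
   Context: Fix $(x_0,t_0)$; $I_k=(t_0-r_k^2,t_0)$, $Q_k=B_{r_k}(x_0)\times I_k$. Filter: $\varphi\in C_c^\infty(B_1(0))$, $\varphi\ge0$, $\int\varphi=1$, $\varphi_\ell(x)=\ell^{-3}\varphi(x/\ell)$; $\Omega_k=\operatorname{curl}(\varphi_{\ell_k}*u)$ (convolution in space). Cutoffs $\chi_k(x,t)=\chi((x-x_0)/r_k,(t-t_0)/r_k^2)$ are parabolic rescalings of one fixed smooth profile $0\le\chi\le1$ compactly supported in $B_1(0)\times(-1,0)$. Strain kernel: $K\Omega$ denotes the tensor with entries $K_{ijm}\Omega_m$, $K_{ijm}(z)=\frac{3}{8\pi|z|^5}(z_j\varepsilon_{ikm}z_k+z_i\varepsilon_{jkm}z_k)$ ($\varepsilon$ the Levi-Civita symbol, repeated indices summed). Shells: for $x\in B_{r_k}(x_0)$ and $m\ge0$, $A_{k,m}(x)=\{y:\Gamma2^mr_k<|x-y|\le2\Gamma2^mr_k\}$, $\mathbb S_{k,m}(x,t)=\int_{A_{k,m}(x)}K(x-y)\Omega_k(y,t)\,dy$, and $$\mu_k^{\mathrm{far,ann}}=r_k\iint_{Q_k}\chi_k\Bigl(\sum_{m=0}^{k}\mathbb S_{k,m}\,\Omega_k\cdot\Omega_k\Bigr)_+dx\,dt .$$ Reservoirs: $\widetilde A_j=\{y:(\Gamma-1)r_j<|y-x_0|\le(2\Gamma+1)r_j\}$, $$\mathfrak A_j=\sup_{k\ge j}\Bigl(r_j^{-1}\iint_{I_k\times\widetilde A_j}|\Omega_k|^2\Bigr)^{1/2},\qquad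 \mathcal Q_k=\Bigl(\int_{I_k}\Bigl(\int_{B_{2r_k}(x_0)}\chi_k|\Omega_k|^2\,dx\Bigr)^2dt\Bigr)^{1/2}.$$ *)

theory Defs
  imports "HOL-Analysis.Analysis"
begin

definition dir_deriv :: "'a \<Rightarrow> ('a::euclidean_space \<Rightarrow> 'b::real_normed_vector) \<Rightarrow> 'a \<Rightarrow> 'b"
  where "dir_deriv v f x = frechet_derivative f (at x) v"

primrec Ck :: "nat \<Rightarrow> ('a::euclidean_space \<Rightarrow> 'b::real_normed_vector) \<Rightarrow> bool"
  where
    "Ck 0 f \<longleftrightarrow> continuous_on UNIV f"
  | "Ck (Suc n) f \<longleftrightarrow> (\<forall>x. f differentiable at x) \<and> (\<forall>v\<in>Basis. Ck n (dir_deriv v f))"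

definition smooth :: "('a::euclidean_space \<Rightarrow> 'b::real_normed_vector) \<Rightarrow> bool"
  where "smooth f \<longleftrightarrow> (\<forall>n. Ck n f)"

definition test_function ::
    "'a set \<Rightarrow> ('a::euclidean_space \<Rightarrow> 'b::real_normed_vector) \<Rightarrow> bool"
  where "test_function U f \<longleftrightarrow>
    smooth f \<and> compact (closure {x. f x \<noteq> 0}) \<and> closure {x. f x \<noteq> 0} \<subseteq> U"

text \<open>
  Space-time fields are functions of (x, t). Measurability and integrals are with respect to
  Lebesgue measure, and all conditions are invariant under changes on null sets.
\<close>

definition square_integrable :: "('a::euclidean_space \<Rightarrow> 'b::euclidean_space) \<Rightarrow> bool"
  where "square_integrable f \<longleftrightarrow>
    f \<in> borel_measurable lebesgue \<and> (\<integral>\<^sup>+ x. ennreal ((norm (f x))\<^sup>2) \<partial>lebesgue) < \<infinity>"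

definition weakly_div_free :: "(real^3 \<Rightarrow> real^3) \<Rightarrow> bool"
  where "weakly_div_free f \<longleftrightarrow>
    (\<forall>g :: real^3 \<Rightarrow> real. test_function UNIV g \<longrightarrow>
       (LINT x|lebesgue. (\<Sum>i\<in>UNIV. f x $ i * dir_deriv (axis i 1) g x)) = 0)"

text \<open>The field f lies in the Sobolev space of order one, with weak Jacobian G.\<close>

definition H1_gradient :: "(real^3 \<Rightarrow> real^3) \<Rightarrow> (real^3 \<Rightarrow> real^3^3) \<Rightarrow> bool"
  where "H1_gradient f G \<longleftrightarrow>
    square_integrable f \<and> square_integrable G \<and>
    (\<forall>g :: real^3 \<Rightarrow> real. test_function UNIV g \<longrightarrow>
       (\<forall>i j. (LINT x|lebesgue. f x $ i * dir_deriv (axis j 1) g x)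
            = - (LINT x|lebesgue. G x $ i $ j * g x)))"

definition time_interval :: "real \<Rightarrow> ereal \<Rightarrow> real set"
  where "time_interval a b = {t. a < t \<and> ereal t < b}"

text \<open>
  The test fields below are compactly supported in space and in time up to (but excluding) b;
  they need not vanish at the initial time a. They are divergence free, so no pressure appears.
\<close>

definition NS_test_field :: "ereal \<Rightarrow> ((real^3) \<times> real \<Rightarrow> real^3) \<Rightarrow> bool"
  where "NS_test_field b \<psi> \<longleftrightarrow>
    test_function (UNIV \<times> {t. ereal t < b}) \<psi> \<and>
    (\<forall>z. (\<Sum>i\<in>UNIV. dir_deriv (axis i 1, 0) \<psi> z $ i) = 0)"

definition NS_weak_integrand ::
    "(real^3 \<Rightarrow> real \<Rightarrow> real^3) \<Rightarrow> ((real^3) \<times> real \<Rightarrow> real^3) \<Rightarrow> (real^3) \<times> real \<Rightarrow> real"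
  where "NS_weak_integrand u \<psi> = (\<lambda>(x, t).
      u x t \<bullet> dir_deriv (0, 1) \<psi> (x, t)
    + (\<Sum>i\<in>UNIV. \<Sum>j\<in>UNIV. u x t $ i * u x t $ j * dir_deriv (axis j 1, 0) \<psi> (x, t) $ i)
    + u x t \<bullet> (\<Sum>j\<in>UNIV. dir_deriv (axis j 1, 0) (dir_deriv (axis j 1, 0) \<psi>) (x, t)))"

text \<open>
  Unit viscosity, no force, initial time a and datum u0; the end time b may be infinite. The
  energy inequality is required from the initial time only, and no weakly continuous
  representative is singled out: the quantities below do not depend on it.
\<close>

definition Leray_Hopf ::
    "real \<Rightarrow> ereal \<Rightarrow> (real^3 \<Rightarrow> real^3) \<Rightarrow> (real^3 \<Rightarrow> real \<Rightarrow> real^3) \<Rightarrow> bool"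
  where "Leray_Hopf a b u0 u \<longleftrightarrow>
    square_integrable u0 \<and> weakly_div_free u0 \<and>
    (\<lambda>(x, t). u x t) \<in> borel_measurable (lebesgue_on (UNIV \<times> time_interval a b)) \<and>
    (\<exists>M::real. AE t in lebesgue_on (time_interval a b).
       (\<integral>\<^sup>+ x. ennreal ((norm (u x t))\<^sup>2) \<partial>lebesgue) \<le> ennreal M) \<and>
    (AE t in lebesgue_on (time_interval a b). weakly_div_free (\<lambda>x. u x t)) \<and>
    (\<forall>\<psi>. NS_test_field b \<psi> \<longrightarrow>
       (LINT z:(UNIV \<times> time_interval a b)|lebesgue. NS_weak_integrand u \<psi> z)
       + (LINT x|lebesgue. u0 x \<bullet> \<psi> (x, a)) = 0) \<and>
    (\<exists>G :: real^3 \<Rightarrow> real \<Rightarrow> real^3^3.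
       (\<lambda>(x, t). G x t) \<in> borel_measurable (lebesgue_on (UNIV \<times> time_interval a b)) \<and>
       (AE t in lebesgue_on (time_interval a b). H1_gradient (\<lambda>x. u x t) (\<lambda>x. G x t)) \<and>
       (\<integral>\<^sup>+ t\<in>time_interval a b. (\<integral>\<^sup>+ x. ennreal ((norm (G x t))\<^sup>2) \<partial>lebesgue) \<partial>lebesgue) < \<infinity> \<and>
       (AE t in lebesgue_on (time_interval a b).
          (\<integral>\<^sup>+ x. ennreal ((norm (u x t))\<^sup>2) \<partial>lebesgue)
          + 2 * (\<integral>\<^sup>+ s\<in>{a<..<t}. (\<integral>\<^sup>+ x. ennreal ((norm (G x s))\<^sup>2) \<partial>lebesgue) \<partial>lebesgue)
          \<le> (\<integral>\<^sup>+ x. ennreal ((norm (u0 x))\<^sup>2) \<partial>lebesgue)))"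

text \<open>In the type 3 the numeral 3 denotes the same element as 0, so 1, 2, 3 are its elements.\<close>

definition levi_civita :: "3 \<Rightarrow> 3 \<Rightarrow> 3 \<Rightarrow> real"
  where "levi_civita i j k =
    (if (i, j, k) \<in> {(1, 2, 3), (2, 3, 1), (3, 1, 2)} then 1
     else if (i, j, k) \<in> {(1, 3, 2), (3, 2, 1), (2, 1, 3)} then -1 else 0)"

definition curl :: "(real^3 \<Rightarrow> real^3) \<Rightarrow> real^3 \<Rightarrow> real^3"
  where "curl F x =
    (\<chi> i. \<Sum>j\<in>UNIV. \<Sum>k\<in>UNIV. levi_civita i j k * dir_deriv (axis j 1) F x $ k)"

definition mollifier :: "(real^3 \<Rightarrow> real) \<Rightarrow> real \<Rightarrow> real^3 \<Rightarrow> real"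
  where "mollifier \<phi> l x = \<phi> (x /\<^sub>R l) / l ^ 3"

definition mollify :: "(real^3 \<Rightarrow> real) \<Rightarrow> real \<Rightarrow> (real^3 \<Rightarrow> real^3) \<Rightarrow> real^3 \<Rightarrow> real^3"
  where "mollify \<phi> l f x = (LINT y|lebesgue. mollifier \<phi> l (x - y) *\<^sub>R f y)"

definition rad :: "nat \<Rightarrow> real"
  where "rad k = (1/2) ^ k"

definition vort ::
    "real \<Rightarrow> (real^3 \<Rightarrow> real) \<Rightarrow> (real^3 \<Rightarrow> real \<Rightarrow> real^3) \<Rightarrow> nat \<Rightarrow> real^3 \<Rightarrow> real \<Rightarrow> real^3"
  where "vort \<sigma> \<phi> u k x t = curl (mollify \<phi> (\<sigma> * rad k) (\<lambda>y. u y t)) x"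

definition strain_kernel :: "real^3 \<Rightarrow> 3 \<Rightarrow> 3 \<Rightarrow> 3 \<Rightarrow> real"
  where "strain_kernel z i j m = 3 / (8 * pi * norm z ^ 5) *
    (\<Sum>k\<in>UNIV. z $ j * levi_civita i k m * z $ k + z $ i * levi_civita j k m * z $ k)"

definition strain_apply :: "real^3 \<Rightarrow> real^3 \<Rightarrow> real^3^3"
  where "strain_apply z w = (\<chi> i j. \<Sum>m\<in>UNIV. strain_kernel z i j m * w $ m)"

definition time_slab :: "real \<Rightarrow> nat \<Rightarrow> real set"
  where "time_slab t0 k = {t0 - (rad k)\<^sup>2 <..< t0}"

definition cutoff ::
    "((real^3) \<times> real \<Rightarrow> real) \<Rightarrow> real^3 \<Rightarrow> real \<Rightarrow> nat \<Rightarrow> real^3 \<Rightarrow> real \<Rightarrow> real"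
  where "cutoff chi x0 t0 k x t = chi ((x - x0) /\<^sub>R rad k, (t - t0) / (rad k)\<^sup>2)"

definition shell :: "real \<Rightarrow> nat \<Rightarrow> nat \<Rightarrow> real^3 \<Rightarrow> (real^3) set"
  where "shell \<Gamma> k m x =
    {y. \<Gamma> * 2 ^ m * rad k < norm (x - y) \<and> norm (x - y) \<le> 2 * \<Gamma> * 2 ^ m * rad k}"

definition shell_strain ::
    "real \<Rightarrow> real \<Rightarrow> (real^3 \<Rightarrow> real) \<Rightarrow> (real^3 \<Rightarrow> real \<Rightarrow> real^3) \<Rightarrow> nat \<Rightarrow> nat \<Rightarrow>
     real^3 \<Rightarrow> real \<Rightarrow> real^3^3"
  where "shell_strain \<Gamma> \<sigma> \<phi> u k m x t =
    (LINT y:shell \<Gamma> k m x|lebesgue. strain_apply (x - y) (vort \<sigma> \<phi> u k y t))"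

definition mu_far_ann ::
    "real \<Rightarrow> real \<Rightarrow> (real^3 \<Rightarrow> real) \<Rightarrow> ((real^3) \<times> real \<Rightarrow> real) \<Rightarrow> real^3 \<Rightarrow> real \<Rightarrow>
     (real^3 \<Rightarrow> real \<Rightarrow> real^3) \<Rightarrow> nat \<Rightarrow> ennreal"
  where "mu_far_ann \<Gamma> \<sigma> \<phi> chi x0 t0 u k =
    ennreal (rad k) *
    (\<integral>\<^sup>+ z\<in>ball x0 (rad k) \<times> time_slab t0 k.
       (case z of (x, t) \<Rightarrow>
          ennreal (cutoff chi x0 t0 k x t *
            max 0 (((\<Sum>m\<in>{0..k}. shell_strain \<Gamma> \<sigma> \<phi> u k m x t) *v vort \<sigma> \<phi> u k x t)
                   \<bullet> vort \<sigma> \<phi> u k x t)))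
     \<partial>lebesgue)"

text \<open>Meant for exponents s > 0 only.\<close>

definition epow :: "ennreal \<Rightarrow> real \<Rightarrow> ennreal"
  where "epow a s = (if a = \<infinity> then \<infinity> else ennreal (enn2real a powr s))"

definition fixed_annulus :: "real \<Rightarrow> real^3 \<Rightarrow> nat \<Rightarrow> (real^3) set"
  where "fixed_annulus \<Gamma> x0 j =
    {y. (\<Gamma> - 1) * rad j < norm (y - x0) \<and> norm (y - x0) \<le> (2 * \<Gamma> + 1) * rad j}"

definition annular_reservoir ::
    "real \<Rightarrow> real \<Rightarrow> (real^3 \<Rightarrow> real) \<Rightarrow> real^3 \<Rightarrow> real \<Rightarrow> (real^3 \<Rightarrow> real \<Rightarrow> real^3) \<Rightarrow> nat \<Rightarrow> ennreal"
  where "annular_reservoir \<Gamma> \<sigma> \<phi> x0 t0 u j =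
    (SUP k\<in>{j..}. epow (ennreal (1 / rad j) *
       (\<integral>\<^sup>+ z\<in>fixed_annulus \<Gamma> x0 j \<times> time_slab t0 k.
          (case z of (x, t) \<Rightarrow> ennreal ((norm (vort \<sigma> \<phi> u k x t))\<^sup>2)) \<partial>lebesgue)) (1/2))"

definition core_reservoir ::
    "real \<Rightarrow> (real^3 \<Rightarrow> real) \<Rightarrow> ((real^3) \<times> real \<Rightarrow> real) \<Rightarrow> real^3 \<Rightarrow> real \<Rightarrow>
     (real^3 \<Rightarrow> real \<Rightarrow> real^3) \<Rightarrow> nat \<Rightarrow> ennreal"
  where "core_reservoir \<sigma> \<phi> chi x0 t0 u k =
    epow (\<integral>\<^sup>+ t\<in>time_slab t0 k.
       (\<integral>\<^sup>+ x\<in>ball x0 (2 * rad k).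
          ennreal (cutoff chi x0 t0 k x t * (norm (vort \<sigma> \<phi> u k x t))\<^sup>2) \<partial>lebesgue)\<^sup>2
       \<partial>lebesgue) (1/2)"

definition lp_norm :: "ennreal \<Rightarrow> (nat \<Rightarrow> ennreal) \<Rightarrow> ennreal"
  where "lp_norm p a =
    (if p = \<infinity> then (SUP j. a j)
     else epow (\<Sum>j. epow (a j) (enn2real p)) (1 / enn2real p))"

end

theory Submission
  imports Defs
begin

text \<open>
  For $x$ in the ball of radius $r_k$, the shell $A_{k,m}(x)$ lies in the fixed annulus
  $\widetilde A_j$ with $j = k - m$. As the kernel decays like $|z|^{-3}$, the Cauchy-Schwarz
  inequality in space bounds the shell strain by $C r_j^{-3/2}$ times the $L^2$ norm of $\Omega_k$
  on $\widetilde A_j$, uniformly in $x$. Cauchy-Schwarz in time then gives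
  $\mu_k \le C \sum_{j \le k} 2^{-(k-j)} \mathfrak A_j \mathcal Q_k$, and summing along the diagonals
  $k - j = d$, with Hoelder's inequality on each of them, leaves the geometric series
  $\sum_d 2^{-d} \le 2$.

  Tonelli's theorem needs a jointly measurable vorticity. The velocity agrees for almost every time
  with a Borel field all of whose time slices are square integrable; for that field the mollified
  curl is a convolution with a derivative of the mollifier, which is jointly Borel.
\<close>

subsection \<open>Hoelder's inequality for extended sequences\<close>

text \<open>The geometric factor is a count of powers: the kernel costs r_j^(-3), Cauchy-Schwarz on
  an annulus of volume at most a multiple of r_j^3 returns r_j^(3/2), the normalisation of the
  reservoir returns r_j^(1/2), and the prefactor r_k leaves r_k / r_j = 2^(-(k-j)). The supremum
  over k in the reservoir is what makes its value depend on j alone, so that the double sum becomes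
  a convolution of two sequences. All estimates live in \<open>ennreal\<close>, so the bound for a
  single k holds for infinite reservoirs too. The nonnegative integral is monotone even for
  nonmeasurable integrands; hence the shell strain, a Bochner integral over a domain moving with x,
  can be majorised pointwise before Tonelli, and only the majorant has to be measurable. The
  majorant still contains the vorticity, and \<open>frechet_derivative\<close> is a choice operator
  whose measurability cannot be read off its definition. This is why differentiation under the
  convolution integral is proved below.\<close>

lemma epow_ennreal: "0 \<le> x \<Longrightarrow> epow (ennreal x) s = ennreal (x powr s)"
  by (simp add: epow_def)

lemma epow_top [simp]: "epow top s = top"
  by (simp add: epow_def)

lemma epow_0 [simp]: "epow 0 s = 0"
  using epow_ennreal[of 0 s] by simp

lemma epow_one [simp]: "epow a 1 = a"
  by (cases a) (simp_all add: epow_ennreal)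

lemma epow_mono:
  assumes "0 \<le> s" "a \<le> b"
  shows "epow a s \<le> epow b s"
  using assms by (cases a; cases b) (auto simp: epow_ennreal powr_mono2 ennreal_leI top_unique)

text \<open>Only infinite factors need care: next to a zero factor both sides vanish, and otherwise
  both are infinite, since \<open>epow\<close> keeps nonzero values nonzero.\<close>

lemma epow_mult:
  assumes "0 < s"
  shows "epow (a * b) s = epow a s * epow b s"
proof (cases "a = top \<or> b = top")
  case True
  then consider "a = 0 \<or> b = 0" | "a * b = top" "epow a s \<noteq> 0" "epow b s \<noteq> 0"
    using assms by (cases a; cases b) (force simp: epow_ennreal ennreal_top_mult ennreal_mult_top)+
  then show ?thesis
    using True by cases (auto simp: ennreal_top_mult ennreal_mult_top)
next
  case False
  then show ?thesis
    by (cases a; cases b) (simp_all add: epow_ennreal powr_mult flip: ennreal_mult)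
qed

lemma epow_epow:
  assumes "0 < r" "0 < s"
  shows "epow (epow a r) s = epow a (r * s)"
  by (cases a) (simp_all add: epow_ennreal powr_powr)

lemma esqrt_square: "epow (a\<^sup>2) (1/2) = a"
  by (cases a) (auto simp: epow_ennreal power_top_ennreal ennreal_power powr_half_sqrt)

lemma square_esqrt: "(epow a (1/2))\<^sup>2 = a"
  by (cases a) (auto simp: epow_ennreal power_top_ennreal ennreal_power powr_half_sqrt)

lemma esqrt_mono_square:
  assumes "a\<^sup>2 \<le> b"
  shows "a \<le> epow b (1/2)"
  using epow_mono[OF _ assms, of "1/2"] by (simp add: esqrt_square)

lemma borel_measurable_epow [measurable]:
  assumes [measurable]: "f \<in> borel_measurable M"
  shows "(\<lambda>x. epow (f x) s) \<in> borel_measurable M"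
  unfolding epow_def by measurable

text \<open>Both families are normalised to unit norm and Young's inequality is applied termwise. A
  vanishing norm forbids the division, but then all products vanish.\<close>

lemma Hoelder_sum_real:
  fixes a b :: "'i \<Rightarrow> real"
  assumes pq: "1 < p" "1 < q" "1/p + 1/q = 1" and fin: "finite I"
    and nn: "\<And>i. i \<in> I \<Longrightarrow> 0 \<le> a i" "\<And>i. i \<in> I \<Longrightarrow> 0 \<le> b i"
  shows "(\<Sum>i\<in>I. a i * b i) \<le> (\<Sum>i\<in>I. a i powr p) powr (1/p) * (\<Sum>i\<in>I. b i powr q) powr (1/q)"
proof -
  define S T where "S = (\<Sum>i\<in>I. a i powr p)" and "T = (\<Sum>i\<in>I. b i powr q)"
  have ST: "0 \<le> S" "0 \<le> T" by (auto simp: S_def T_def intro: sum_nonneg)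
  show ?thesis
  proof (cases "S = 0 \<or> T = 0")
    case True
    then have "(\<forall>i\<in>I. a i = 0) \<or> (\<forall>i\<in>I. b i = 0)"
      using fin by (auto simp: S_def T_def sum_nonneg_eq_0_iff)
    then have "(\<Sum>i\<in>I. a i * b i) = 0" by (auto intro!: sum.neutral)
    then show ?thesis by simp
  next
    case False
    define X Y where "X = S powr (1/p)" and "Y = T powr (1/q)"
    from False ST have XY: "0 < X" "0 < Y" "X powr p = S" "Y powr q = T" "S > 0" "T > 0"
      using pq by (auto simp: X_def Y_def powr_powr)
    have "(\<Sum>i\<in>I. (a i / X) * (b i / Y))
        \<le> (\<Sum>i\<in>I. (a i / X) powr p / p + (b i / Y) powr q / q)"
      using nn XY by (intro sum_mono Youngs_inequality pq) auto
    also have "\<dots> = (\<Sum>i\<in>I. a i powr p) / S / p + (\<Sum>i\<in>I. b i powr q) / T / q"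
      using nn XY by (simp add: powr_divide sum.distrib sum_divide_distrib)
    also have "\<dots> = 1"
      using XY pq by (simp flip: S_def T_def)
    finally have "(\<Sum>i\<in>I. a i * b i) / (X * Y) \<le> 1"
      by (simp add: sum_divide_distrib)
    then show ?thesis
      using XY(1,2) by (simp add: pos_divide_le_eq flip: X_def Y_def S_def T_def)
  qed
qed

lemma Hoelder_sum_ennreal:
  fixes a b :: "'i \<Rightarrow> ennreal"
  assumes pq: "1 < p" "1 < q" "1/p + 1/q = 1" and fin: "finite I"
    and nt: "\<And>i. i \<in> I \<Longrightarrow> a i < top" "\<And>i. i \<in> I \<Longrightarrow> b i < top"
  shows "(\<Sum>i\<in>I. a i * b i)
    \<le> epow (\<Sum>i\<in>I. epow (a i) p) (1/p) * epow (\<Sum>i\<in>I. epow (b i) q) (1/q)"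
proof -
  define a' b' where "a' = (\<lambda>i. enn2real (a i))" and "b' = (\<lambda>i. enn2real (b i))"
  have a: "a i = ennreal (a' i)" and b: "b i = ennreal (b' i)" if "i \<in> I" for i
    using nt[OF that] by (auto simp: a'_def b'_def)
  have nn: "0 \<le> a' i" "0 \<le> b' i" for i by (auto simp: a'_def b'_def)
  have "(\<Sum>i\<in>I. a i * b i) = ennreal (\<Sum>i\<in>I. a' i * b' i)"
    using a b nn by (simp add: sum_ennreal flip: ennreal_mult)
  also have "\<dots> \<le> ennreal ((\<Sum>i\<in>I. a' i powr p) powr (1/p) * (\<Sum>i\<in>I. b' i powr q) powr (1/q))"
    using nn by (intro ennreal_leI Hoelder_sum_real pq fin)
  also have "\<dots> = epow (\<Sum>i\<in>I. epow (a i) p) (1/p) * epow (\<Sum>i\<in>I. epow (b i) q) (1/q)"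
    using a b nn by (simp add: epow_ennreal sum_ennreal sum_nonneg ennreal_mult)
  finally show ?thesis .
qed

section \<open>Sequence norms and the pairing of conjugate exponents\<close>

lemma sum_inj_le_suminf_ennreal:
  fixes f :: "nat \<Rightarrow> ennreal"
  assumes "finite I" "inj_on g I"
  shows "(\<Sum>i\<in>I. f (g i)) \<le> (\<Sum>n. f n)"
proof -
  have "(\<Sum>i\<in>I. f (g i)) = sum f (g ` I)"
    using assms by (simp add: sum.reindex)
  also have "\<dots> \<le> (\<Sum>n. f n)"
    using assms by (intro sum_le_suminf) auto
  finally show ?thesis .
qed

lemma lp_norm_real: "0 < r \<Longrightarrow> lp_norm (ennreal r) a = epow (\<Sum>j. epow (a j) r) (1 / r)"
  by (simp add: lp_norm_def)

lemma lp_norm_ge: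
  assumes "1 \<le> p"
  shows "a j \<le> lp_norm p a"
proof (cases p)
  case (real r)
  then have r: "1 \<le> r" using assms by simp
  have "epow (a j) r \<le> (\<Sum>j. epow (a j) r)"
    using sum_le_suminf[of "\<lambda>j. epow (a j) r" "{j}"] by simp
  then have "epow (epow (a j) r) (1/r) \<le> epow (\<Sum>j. epow (a j) r) (1/r)"
    using r by (intro epow_mono) auto
  then show ?thesis
    using r real by (simp add: epow_epow lp_norm_real)
qed (auto simp: lp_norm_def intro: SUP_upper)

text \<open>Two index maps are allowed so that a sequence can be paired with a shift of another;
  injectivity makes each finite sum a part of the full series. The endpoint pair 1 and \<infinity>
  is treated separately because Young's inequality requires exponents above 1.\<close>

lemma Hoelder_lp_norm:
  fixes A B :: "nat \<Rightarrow> ennreal"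
  assumes pq: "1 \<le> p" "1 \<le> q" "1 / p + 1 / q = 1"
    and nt: "lp_norm p A < \<infinity>" "lp_norm q B < \<infinity>"
    and I: "finite I" "inj_on f I" "inj_on g I"
  shows "(\<Sum>i\<in>I. A (f i) * B (g i)) \<le> lp_norm p A * lp_norm q B"
proof -
  \<comment> \<open>The sequences are quantified afresh, so that the same fact with the roles
    exchanged also covers q = \<infinity>.\<close>
  have endpoint: "(\<Sum>i\<in>I. A (f i) * B (g i)) \<le> lp_norm \<infinity> A * lp_norm 1 B"
    if "inj_on g I" for A B :: "nat \<Rightarrow> ennreal" and f g
  proof -
    have "(\<Sum>i\<in>I. A (f i) * B (g i)) \<le> (\<Sum>i\<in>I. lp_norm \<infinity> A * B (g i))"
      by (intro sum_mono mult_right_mono lp_norm_ge) auto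
    also have "\<dots> \<le> lp_norm \<infinity> A * lp_norm 1 B"
      using sum_inj_le_suminf_ennreal[OF I(1) that, of B]
      by (simp add: lp_norm_def mult_left_mono flip: sum_distrib_left)
    finally show ?thesis .
  qed
  \<comment> \<open>At an endpoint one reciprocal is 0, and conjugacy reduces to this equation; the
    value r = 0 is excluded because 1 / 0 is infinite in \<open>ennreal\<close>.\<close>
  have inv_eq_1: "x = 1" if "1 / x = 1" for x :: ennreal
  proof (cases x)
    case (real r)
    with that show ?thesis
      by (cases "r = 0") (auto simp: divide_ennreal simp flip: ennreal_1)
  qed (use that in simp)
  consider "p = \<infinity>" | "q = \<infinity>" | r s where "p = ennreal r" "q = ennreal s" "1 \<le> r" "1 \<le> s"
    using pq by (cases p; cases q) auto
  then show ?thesis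
  proof cases
    case 1
    then have "q = 1" using pq inv_eq_1 by simp
    with 1 endpoint[OF I(3), of A f B] show ?thesis by simp
  next
    case 2
    then have "p = 1" using pq inv_eq_1 by simp
    with 2 endpoint[OF I(2), of B g A] show ?thesis by (simp add: mult.commute)
  next
    case (3 r s)
    then have "ennreal (1 / r + 1 / s) = ennreal 1"
      using pq by (simp add: ennreal_plus flip: divide_ennreal)
    with 3 have rs: "1 / r + 1 / s = 1"
      by (subst (asm) ennreal_inj) auto
    then have "0 < 1 / r" "0 < 1 / s" using 3 by auto
    then have "1 / r < 1" "1 / s < 1" using rs by linarith+
    then have r1: "1 < r" "1 < s" using 3 by auto
    \<comment> \<open>Finite norms bound every entry, which is the finiteness that the passage to
      real numbers requires.\<close>
    have fin: "A i < top" "B i < top" for i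
      using lp_norm_ge[OF pq(1), of A i] lp_norm_ge[OF pq(2), of B i] nt by (auto intro: le_less_trans)
    have "(\<Sum>i\<in>I. A (f i) * B (g i))
        \<le> epow (\<Sum>i\<in>I. epow (A (f i)) r) (1/r) * epow (\<Sum>i\<in>I. epow (B (g i)) s) (1/s)"
      using fin by (intro Hoelder_sum_ennreal r1 rs I)
    also have "\<dots> \<le> lp_norm p A * lp_norm q B"
      using 3 r1 sum_inj_le_suminf_ennreal[OF I(1,2), of "\<lambda>j. epow (A j) r"]
        sum_inj_le_suminf_ennreal[OF I(1,3), of "\<lambda>j. epow (B j) s"]
      by (auto simp: lp_norm_real intro!: mult_mono epow_mono)
    finally show ?thesis .
  qed
qed

lemma sum_geometric_convolution_le:
  fixes A B :: "nat \<Rightarrow> ennreal"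
  assumes "1 \<le> p" "1 \<le> q" "1 / p + 1 / q = 1"
    and "lp_norm p A < \<infinity>" "lp_norm q B < \<infinity>"
  shows "(\<Sum>k\<in>{0..N}. \<Sum>j\<in>{0..k}. ennreal ((1/2) ^ (k - j)) * A j * B k)
    \<le> 2 * (lp_norm p A * lp_norm q B)"
proof -
  \<comment> \<open>Writing k as j + (k - j) turns the summand into a function of j and d = k - j,
    as the triangular reindexing expects.\<close>
  have "(\<Sum>k\<in>{0..N}. \<Sum>j\<in>{0..k}. ennreal ((1/2) ^ (k - j)) * A j * B k)
      = (\<Sum>k\<le>N. \<Sum>j\<le>k. ennreal ((1/2) ^ (k - j)) * A j * B (j + (k - j)))"
    by (simp add: atLeast0AtMost)
  also have "\<dots> = (\<Sum>(j, d)\<in>{(j, d). j + d \<le> N}. ennreal ((1/2) ^ d) * A j * B (j + d))"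
    by (rule sum.triangle_reindex_eq[symmetric])
  \<comment> \<open>The triangle is enlarged to a square, at no cost for nonnegative terms, so that
    the range of j no longer depends on d.\<close>
  also have "\<dots> \<le> (\<Sum>(j, d)\<in>{..N} \<times> {..N}. ennreal ((1/2) ^ d) * A j * B (j + d))"
    by (intro sum_mono2) auto
  also have "\<dots> = (\<Sum>d\<le>N. ennreal ((1/2) ^ d) * (\<Sum>j\<le>N. A j * B (j + d)))"
    by (subst sum.cartesian_product[symmetric], subst sum.swap)
       (simp add: sum_distrib_left mult.assoc)
  also have "\<dots> \<le> (\<Sum>d\<le>N. ennreal ((1/2) ^ d) * (lp_norm p A * lp_norm q B))"
    using assms
    by (intro sum_mono mult_left_mono Hoelder_lp_norm[where f = "\<lambda>j. j"]) (auto simp: inj_on_def)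
  also have "\<dots> = (\<Sum>d\<le>N. ennreal ((1/2) ^ d)) * (lp_norm p A * lp_norm q B)"
    by (rule sum_distrib_right[symmetric])
  also have "\<dots> \<le> 2 * (lp_norm p A * lp_norm q B)"
  proof (rule mult_right_mono)
    have "(\<Sum>d\<le>N. (1/2::real) ^ d) \<le> 2"
      unfolding sum_gp0 by (simp add: field_simps)
    then have "ennreal (\<Sum>d\<le>N. (1/2::real) ^ d) \<le> ennreal 2"
      by (rule ennreal_leI)
    then show "(\<Sum>d\<le>N. ennreal ((1/2) ^ d)) \<le> 2"
      by (simp add: sum_ennreal)
  qed simp
  finally show ?thesis .
qed

subsection \<open>Far annular stretching of a Borel field\<close>

text \<open>The norm of the matrix type is the Frobenius norm, the Euclidean norm of the row norms,
  so Cauchy-Schwarz can be applied row by row.\<close>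

lemma norm_matrix_vector_mult_le:
  fixes A :: "real^'n^'m"
  shows "norm (A *v w) \<le> norm A * norm w"
proof -
  have "norm (A *v w) = L2_set (\<lambda>i. norm (A $ i \<bullet> w)) UNIV"
    by (simp add: norm_vec_def matrix_vector_mul_component)
  also have "\<dots> \<le> L2_set (\<lambda>i. norm (A $ i) * norm w) UNIV"
    by (intro L2_set_mono) (auto simp: Cauchy_Schwarz_ineq2)
  also have "\<dots> = norm A * norm w"
    by (simp add: norm_vec_def[of A] L2_set_left_distrib)
  finally show ?thesis .
qed

text \<open>The sum has three indices with two terms each, all at most |z|^2 in size, and 3 * 6 / (8
  * pi) < 1. At z = 0 both sides are 0, as division by zero gives 0.\<close>

lemma abs_strain_kernel_le: "\<bar>strain_kernel z i j m\<bar> \<le> 1 / norm z ^ 3"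
proof (cases "z = 0")
  case False
  have lc: "\<bar>levi_civita a b c\<bar> \<le> 1" for a b c
    by (auto simp: levi_civita_def)
  have zz: "\<bar>z $ a * levi_civita b c d * z $ e\<bar> \<le> (norm z)\<^sup>2" for a b c d e
  proof -
    have "\<bar>z $ a\<bar> * \<bar>levi_civita b c d\<bar> * \<bar>z $ e\<bar> \<le> norm z * 1 * norm z"
      by (intro mult_mono lc component_le_norm_cart) auto
    then show ?thesis by (simp add: abs_mult power2_eq_square)
  qed
  have "\<bar>z $ j * levi_civita i k m * z $ k + z $ i * levi_civita j k m * z $ k\<bar>
      \<le> 2 * (norm z)\<^sup>2" for k
    using abs_triangle_ineq[of "z $ j * levi_civita i k m * z $ k"] zz[of j i k m k] zz[of i j k m k]
    by (smt (verit))
  then have "\<bar>\<Sum>k\<in>UNIV. z $ j * levi_civita i k m * z $ k + z $ i * levi_civita j k m * z $ k\<bar>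
      \<le> (\<Sum>k\<in>(UNIV::3 set). 2 * (norm z)\<^sup>2)"
    by (intro sum_abs[THEN order_trans] sum_mono)
  then have "\<bar>strain_kernel z i j m\<bar> \<le> 3 / (8 * pi * norm z ^ 5) * (6 * (norm z)\<^sup>2)"
    unfolding strain_kernel_def abs_mult by (intro mult_mono) auto
  also have "\<dots> = 18 / (8 * pi) * (1 / norm z ^ 3)"
    using False by (simp add: field_simps power_numeral_reduce)
  also have "\<dots> \<le> 1 * (1 / norm z ^ 3)"
    using pi_gt3 by (intro mult_right_mono) (auto simp: divide_le_eq)
  finally show ?thesis by simp
qed (simp add: strain_kernel_def)

lemma norm_le_sum_components:
  fixes A :: "real^'n^'m"
  shows "norm A \<le> (\<Sum>i\<in>UNIV. \<Sum>j\<in>UNIV. \<bar>A $ i $ j\<bar>)"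
proof -
  have "norm A \<le> (\<Sum>i\<in>UNIV. norm (A $ i))"
    unfolding norm_vec_def[of A] by (rule L2_set_le_sum) auto
  also have "\<dots> \<le> (\<Sum>i\<in>UNIV. \<Sum>j\<in>UNIV. \<bar>A $ i $ j\<bar>)"
    by (intro sum_mono norm_le_l1_cart)
  finally show ?thesis .
qed

text \<open>The factor 27 counts nine matrix entries with three summands each.\<close>

lemma norm_strain_apply_le: "norm (strain_apply z w) \<le> 27 / norm z ^ 3 * norm w"
proof -
  have "\<bar>strain_apply z w $ i $ j\<bar> \<le> 3 * (1 / norm z ^ 3 * norm w)" for i j
  proof -
    have "\<bar>strain_apply z w $ i $ j\<bar> \<le> (\<Sum>m\<in>UNIV. \<bar>strain_kernel z i j m * w $ m\<bar>)"
      by (simp add: strain_apply_def)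
    also have "\<dots> \<le> (\<Sum>m\<in>(UNIV::3 set). 1 / norm z ^ 3 * norm w)"
      unfolding abs_mult by (intro sum_mono mult_mono abs_strain_kernel_le component_le_norm_cart) auto
    finally show ?thesis by simp
  qed
  then have "(\<Sum>i\<in>UNIV. \<Sum>j\<in>UNIV. \<bar>strain_apply z w $ i $ j\<bar>)
      \<le> (\<Sum>i\<in>(UNIV::3 set). \<Sum>j\<in>(UNIV::3 set). 3 * (1 / norm z ^ 3 * norm w))"
    by (intro sum_mono)
  with norm_le_sum_components[of "strain_apply z w"] show ?thesis by simp
qed

text \<open>A function that is not integrable has Bochner integral 0, so the bound holds for every
  function, and the shell integrals can be estimated before anything is known about their
  convergence.\<close>

lemma norm_integral_le_nn_integral:
  fixes f :: "'a \<Rightarrow> 'b::{banach, second_countable_topology}"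
  shows "ennreal (norm (integral\<^sup>L M f)) \<le> (\<integral>\<^sup>+ x. ennreal (norm (f x)) \<partial>M)"
  by (cases "integrable M f") (simp_all add: integral_norm_bound_ennreal not_integrable_integral_eq)

section \<open>Dyadic radii, shells and fixed annuli\<close>

lemma rad_pos [simp]: "0 < rad k"
  by (simp add: rad_def)

lemma rad_nonneg [simp]: "0 \<le> rad k"
  by (simp add: rad_def)

lemma rad_le_one: "rad k \<le> 1"
  by (simp add: rad_def power_le_one)

lemma rad_diff: "m \<le> k \<Longrightarrow> rad (k - m) = 2 ^ m * rad k"
  by (simp add: rad_def power_diff field_simps power_one_over)

text \<open>Moving the centre from x to x0 changes distances by less than r_k, hence by less than
  the radius of index k - m; this is the origin of the radii \<Gamma> - 1 and 2 * \<Gamma> +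
  1.\<close>

lemma shell_subset_fixed_annulus:
  assumes "x \<in> ball x0 (rad k)" "m \<le> k"
  shows "shell \<Gamma> k m x \<subseteq> fixed_annulus \<Gamma> x0 (k - m)"
proof
  fix y assume y: "y \<in> shell \<Gamma> k m x"
  have x: "norm (x - x0) < rad k"
    using assms by (simp add: dist_norm norm_minus_commute)
  have "(1::real) * rad k \<le> 2 ^ m * rad k"
    by (intro mult_right_mono) auto
  then have r: "rad k \<le> rad (k - m)"
    using assms by (simp add: rad_diff)
  have "\<Gamma> * rad (k - m) < norm (x - y)" "norm (x - y) \<le> 2 * \<Gamma> * rad (k - m)"
    using y assms by (simp_all add: shell_def rad_diff)
  moreover have "norm (y - x0) \<le> norm (x - y) + norm (x - x0)"
    using norm_triangle_ineq4[of "x - x0" "x - y"] by simp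
  moreover have "norm (x - y) \<le> norm (y - x0) + norm (x - x0)"
    using norm_triangle_ineq4[of "x - x0" "y - x0"] by simp
  ultimately show "y \<in> fixed_annulus \<Gamma> x0 (k - m)"
    using x r by (simp add: fixed_annulus_def algebra_simps)
qed

lemma Cauchy_Schwarz_nn_integral_esqrt:
  assumes "f \<in> borel_measurable M" "g \<in> borel_measurable M"
  shows "(\<integral>\<^sup>+x. f x * g x \<partial>M)
    \<le> epow (\<integral>\<^sup>+x. (f x)\<^sup>2 \<partial>M) (1/2) * epow (\<integral>\<^sup>+x. (g x)\<^sup>2 \<partial>M) (1/2)"
  using esqrt_mono_square[OF Cauchy_Schwarz_nn_integral[OF assms]] by (simp add: epow_mult)

text \<open>The factor 27 is the kernel bound; under the root stands the volume of a ball of radius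
  2 * \<Gamma> + 1, which bounds that of the annulus at unit scale.\<close>

definition annulus_const :: "real \<Rightarrow> real"
  where "annulus_const \<Gamma> = 27 * sqrt (unit_ball_vol 3 * (2 * \<Gamma> + 1) ^ 3)"

lemma fixed_annulus_sets [measurable]: "fixed_annulus \<Gamma> x0 j \<in> sets borel"
  unfolding fixed_annulus_def by measurable

lemma emeasure_fixed_annulus_le:
  assumes "0 \<le> \<Gamma>"
  shows "emeasure lborel (fixed_annulus \<Gamma> x0 j)
    \<le> ennreal (unit_ball_vol 3 * (2 * \<Gamma> + 1) ^ 3 * rad j ^ 3)"
proof -
  have "emeasure lborel (fixed_annulus \<Gamma> x0 j) \<le> emeasure lborel (cball x0 ((2 * \<Gamma> + 1) * rad j))"
    by (intro emeasure_mono) (auto simp: fixed_annulus_def dist_norm norm_minus_commute)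
  also have "\<dots> = ennreal (unit_ball_vol 3 * (2 * \<Gamma> + 1) ^ 3 * rad j ^ 3)"
    using assms by (subst emeasure_cball) (auto simp: power_mult_distrib mult.assoc less_imp_le)
  finally show ?thesis .
qed

text \<open>Cauchy-Schwarz against the indicator of the annulus; the root of its volume bound
  contributes r_j^(3/2), kept as a product with a square root.\<close>

lemma nn_integral_fixed_annulus_le:
  assumes "0 \<le> \<Gamma>" and [measurable]: "w \<in> borel_measurable borel"
  shows "(\<integral>\<^sup>+ y\<in>fixed_annulus \<Gamma> x0 j. ennreal (norm (w y)) \<partial>lborel)
    \<le> ennreal (sqrt (unit_ball_vol 3 * (2 * \<Gamma> + 1) ^ 3) * (rad j * sqrt (rad j)))
      * epow (\<integral>\<^sup>+ y\<in>fixed_annulus \<Gamma> x0 j. ennreal ((norm (w y))\<^sup>2) \<partial>lborel) (1/2)"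
proof -
  let ?A = "fixed_annulus \<Gamma> x0 j"
  have r3: "sqrt (rad j ^ 3) = rad j * sqrt (rad j)"
    by (simp add: power3_eq_cube real_sqrt_mult less_imp_le)
  have "(\<integral>\<^sup>+ y\<in>?A. ennreal (norm (w y)) \<partial>lborel)
      = (\<integral>\<^sup>+ y. indicator ?A y * (ennreal (norm (w y)) * indicator ?A y) \<partial>lborel)"
    by (intro nn_integral_cong) (auto split: split_indicator)
  also have "\<dots> \<le> epow (\<integral>\<^sup>+ y. (indicator ?A y)\<^sup>2 \<partial>lborel) (1/2)
      * epow (\<integral>\<^sup>+ y. (ennreal (norm (w y)) * indicator ?A y)\<^sup>2 \<partial>lborel) (1/2)"
    by (intro Cauchy_Schwarz_nn_integral_esqrt) auto
  also have "(\<integral>\<^sup>+ y. (indicator ?A y)\<^sup>2 \<partial>lborel) = emeasure lborel ?A"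
  proof -
    have "(indicator ?A y :: ennreal)\<^sup>2 = indicator ?A y" for y
      by (auto split: split_indicator)
    then show ?thesis by simp
  qed
  also have "(\<integral>\<^sup>+ y. (ennreal (norm (w y)) * indicator ?A y)\<^sup>2 \<partial>lborel)
      = (\<integral>\<^sup>+ y\<in>?A. ennreal ((norm (w y))\<^sup>2) \<partial>lborel)"
    by (auto intro!: nn_integral_cong split: split_indicator simp: ennreal_power)
  also have "epow (emeasure lborel ?A) (1/2)
      \<le> epow (ennreal (unit_ball_vol 3 * (2 * \<Gamma> + 1) ^ 3 * rad j ^ 3)) (1/2)"
    using assms by (intro epow_mono emeasure_fixed_annulus_le) auto
  also have "\<dots> = ennreal (sqrt (unit_ball_vol 3 * (2 * \<Gamma> + 1) ^ 3) * (rad j * sqrt (rad j)))"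
    using assms by (subst epow_ennreal) (auto simp: powr_half_sqrt real_sqrt_mult r3 less_imp_le)
  finally show ?thesis
    by (simp add: mult_right_mono)
qed

text \<open>On the shell |x - y| exceeds \<Gamma> times the radius r of index k - m, hence r itself,
  so the kernel is at most 27 / r^3 there. The resulting bound no longer involves x and can leave
  the spatial integral later.\<close>

lemma shell_strain_le:
  assumes "1 < \<Gamma>" "x \<in> ball x0 (rad k)" "m \<le> k" and w[measurable]: "w \<in> borel_measurable borel"
  shows "ennreal (norm (LINT y:shell \<Gamma> k m x|lebesgue. strain_apply (x - y) (w y)))
    \<le> ennreal (annulus_const \<Gamma> / (rad (k - m) * sqrt (rad (k - m))))
      * epow (\<integral>\<^sup>+ y\<in>fixed_annulus \<Gamma> x0 (k - m). ennreal ((norm (w y))\<^sup>2) \<partial>lborel) (1/2)"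
proof -
  let ?r = "rad (k - m)" and ?A = "fixed_annulus \<Gamma> x0 (k - m)"
  have ptw: "norm (strain_apply (x - y) (w y)) \<le> 27 / ?r ^ 3 * norm (w y)"
    if y: "y \<in> shell \<Gamma> k m x" for y
  proof -
    have "1 * ?r \<le> \<Gamma> * ?r"
      using assms by (intro mult_right_mono) (auto simp: less_imp_le)
    also have "\<dots> < norm (x - y)"
      using y assms by (simp add: shell_def rad_diff)
    finally have "?r ^ 3 \<le> norm (x - y) ^ 3"
      by (intro power_mono) (auto simp: less_imp_le)
    then have "27 / norm (x - y) ^ 3 \<le> 27 / ?r ^ 3"
      by (intro divide_left_mono) (auto intro!: mult_pos_pos zero_less_power order_less_le_trans[OF _ \<open>?r ^ 3 \<le> _\<close>])
    then show ?thesis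
      using norm_strain_apply_le[of "x - y" "w y"] by (meson mult_right_mono norm_ge_zero order_trans)
  qed
  have "ennreal (norm (LINT y:shell \<Gamma> k m x|lebesgue. strain_apply (x - y) (w y)))
      \<le> (\<integral>\<^sup>+ y. ennreal (norm (indicator (shell \<Gamma> k m x) y *\<^sub>R strain_apply (x - y) (w y))) \<partial>lebesgue)"
    unfolding set_lebesgue_integral_def by (rule norm_integral_le_nn_integral)
  also have "\<dots> \<le> (\<integral>\<^sup>+ y. ennreal (27 / ?r ^ 3) * (ennreal (norm (w y)) * indicator ?A y) \<partial>lebesgue)"
    using shell_subset_fixed_annulus[OF assms(2,3), of \<Gamma>] ptw
    by (intro nn_integral_mono)
       (auto split: split_indicator intro!: ennreal_leI simp: less_imp_le simp flip: ennreal_mult)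
  also have "\<dots> = ennreal (27 / ?r ^ 3) * (\<integral>\<^sup>+ y\<in>?A. ennreal (norm (w y)) \<partial>lborel)"
    unfolding nn_integral_completion by (rule nn_integral_cmult) measurable
  also have "\<dots> \<le> ennreal (27 / ?r ^ 3)
      * (ennreal (sqrt (unit_ball_vol 3 * (2 * \<Gamma> + 1) ^ 3) * (?r * sqrt ?r))
      * epow (\<integral>\<^sup>+ y\<in>?A. ennreal ((norm (w y))\<^sup>2) \<partial>lborel) (1/2))"
    using assms by (intro mult_left_mono nn_integral_fixed_annulus_le) auto
  also have "\<dots> = ennreal (27 / ?r ^ 3 * (sqrt (unit_ball_vol 3 * (2 * \<Gamma> + 1) ^ 3) * (?r * sqrt ?r)))
      * epow (\<integral>\<^sup>+ y\<in>?A. ennreal ((norm (w y))\<^sup>2) \<partial>lborel) (1/2)"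
    using assms by (subst ennreal_mult) (auto simp: less_imp_le mult.assoc)
  also have "27 / ?r ^ 3 * (sqrt (unit_ball_vol 3 * (2 * \<Gamma> + 1) ^ 3) * (?r * sqrt ?r))
      = annulus_const \<Gamma> / (?r * sqrt ?r)"
  proof -
    have "sqrt ?r * sqrt ?r = ?r" "sqrt ?r \<noteq> 0" "?r \<noteq> 0"
      by (simp_all add: less_imp_le order_less_imp_not_eq2)
    then show ?thesis
      unfolding annulus_const_def power3_eq_cube
      by (simp add: divide_simps mult.assoc mult.left_commute)
  qed
  finally show ?thesis .
qed

text \<open>Time is the outer variable, so that the spatial factors can be estimated slice by slice
  before Cauchy-Schwarz in time.\<close>

lemma nn_integral_lborel_prod_slice:
  fixes f :: "'a::euclidean_space \<Rightarrow> real \<Rightarrow> ennreal"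
  assumes [measurable]: "case_prod f \<in> borel_measurable borel"
    and [measurable]: "A \<in> sets borel" "I \<in> sets borel"
  shows "(\<integral>\<^sup>+ z\<in>A \<times> I. case_prod f z \<partial>lborel) = (\<integral>\<^sup>+ t\<in>I. (\<integral>\<^sup>+ x\<in>A. f x t \<partial>lborel) \<partial>lborel)"
proof -
  have [measurable]: "case_prod f \<in> borel_measurable (lborel \<Otimes>\<^sub>M lborel)"
    by (simp add: lborel_prod)
  have "(\<integral>\<^sup>+ z\<in>A \<times> I. case_prod f z \<partial>lborel)
      = (\<integral>\<^sup>+ z. case_prod f z * indicator (A \<times> I) z \<partial>(lborel \<Otimes>\<^sub>M lborel))"
    by (simp add: lborel_prod)
  also have "\<dots> = (\<integral>\<^sup>+ t. (\<integral>\<^sup>+ x. f x t * indicator (A \<times> I) (x, t) \<partial>lborel) \<partial>lborel)"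
    by (subst lborel_pair.nn_integral_snd[symmetric]) simp_all
  also have "\<dots> = (\<integral>\<^sup>+ t\<in>I. (\<integral>\<^sup>+ x\<in>A. f x t \<partial>lborel) \<partial>lborel)"
    by (intro nn_integral_cong) (simp add: indicator_times split: split_indicator)
  finally show ?thesis .
qed

text \<open>The strain is separated from the weight \<open>c * (norm w)\<^sup>2\<close>, which stays
  intact because it is the density integrated in the core reservoir.\<close>

lemma stretching_pointwise_le:
  fixes S :: "nat \<Rightarrow> real^3^3"
  assumes "0 \<le> c"
  shows "ennreal (c * max 0 (((\<Sum>m\<in>M. S m) *v w) \<bullet> w))
    \<le> (\<Sum>m\<in>M. ennreal (norm (S m))) * ennreal (c * (norm w)\<^sup>2)"
proof -
  let ?N = "\<Sum>m\<in>M. norm (S m)"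
  have "((\<Sum>m\<in>M. S m) *v w) \<bullet> w \<le> norm ((\<Sum>m\<in>M. S m) *v w) * norm w"
    by (rule norm_cauchy_schwarz)
  also have "\<dots> \<le> norm (\<Sum>m\<in>M. S m) * norm w * norm w"
    by (intro mult_right_mono norm_matrix_vector_mult_le) auto
  also have "\<dots> \<le> ?N * norm w * norm w"
    by (intro mult_right_mono norm_sum) auto
  finally have "c * max 0 (((\<Sum>m\<in>M. S m) *v w) \<bullet> w) \<le> c * (?N * norm w * norm w)"
    using assms by (intro mult_left_mono) (auto simp: sum_nonneg)
  also have "\<dots> = ?N * (c * (norm w)\<^sup>2)"
    by (simp add: power2_eq_square)
  finally have "ennreal (c * max 0 (((\<Sum>m\<in>M. S m) *v w) \<bullet> w)) \<le> ennreal (?N * (c * (norm w)\<^sup>2))"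
    by (rule ennreal_leI)
  also have "\<dots> = (\<Sum>m\<in>M. ennreal (norm (S m))) * ennreal (c * (norm w)\<^sup>2)"
    using assms by (subst ennreal_mult) (auto simp: sum_nonneg)
  finally show ?thesis .
qed

text \<open>An arbitrary Borel field and nonnegative weight take the places of vorticity and cutoff,
  which isolates the harmonic analysis from the fluid. Each summand still carries the annular energy
  on the slab of index k; the supremum is taken afterwards.\<close>

lemma far_annular_estimate:
  fixes W :: "real^3 \<Rightarrow> real \<Rightarrow> real^3" and c :: "real^3 \<Rightarrow> real \<Rightarrow> real"
  assumes \<Gamma>: "1 < \<Gamma>"
    and W[measurable]: "case_prod W \<in> borel_measurable borel"
    and c[measurable]: "case_prod c \<in> borel_measurable borel" and c0: "\<And>x t. 0 \<le> c x t"
  shows "ennreal (rad k) *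
      (\<integral>\<^sup>+ z\<in>ball x0 (rad k) \<times> time_slab t0 k. (case z of (x, t) \<Rightarrow>
         ennreal (c x t * max 0 (((\<Sum>m\<in>{0..k}. LINT y:shell \<Gamma> k m x|lebesgue.
           strain_apply (x - y) (W y t)) *v W x t) \<bullet> W x t))) \<partial>lebesgue)
    \<le> ennreal (annulus_const \<Gamma>) * (\<Sum>j\<in>{0..k}. ennreal ((1/2) ^ (k - j))
      * epow (ennreal (1 / rad j) * (\<integral>\<^sup>+ z\<in>fixed_annulus \<Gamma> x0 j \<times> time_slab t0 k.
          (case z of (x, t) \<Rightarrow> ennreal ((norm (W x t))\<^sup>2)) \<partial>lebesgue)) (1/2)
      * epow (\<integral>\<^sup>+ t\<in>time_slab t0 k. (\<integral>\<^sup>+ x\<in>ball x0 (2 * rad k).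
          ennreal (c x t * (norm (W x t))\<^sup>2) \<partial>lebesgue)\<^sup>2 \<partial>lebesgue) (1/2))"
proof -
  define I where "I = time_slab t0 k"
  have I[measurable]: "I \<in> sets borel" by (simp add: I_def time_slab_def)
  have Wb[measurable]: "(\<lambda>z. W (fst z) (snd z)) \<in> borel_measurable borel"
    and cb[measurable]: "(\<lambda>z. c (fst z) (snd z)) \<in> borel_measurable borel"
    using W c by (simp_all add: case_prod_beta')
  have snd_borel[measurable]: "(snd :: (real^3) \<times> real \<Rightarrow> real) \<in> borel_measurable borel"
    by (intro borel_measurable_continuous_onI continuous_intros)
  have Wp[measurable]: "(\<lambda>z. W (fst z) (snd z)) \<in> borel_measurable (lborel \<Otimes>\<^sub>M lborel)"
    and cp[measurable]: "(\<lambda>z. c (fst z) (snd z)) \<in> borel_measurable (lborel \<Otimes>\<^sub>M lborel)"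
    using W c by (simp_all add: lborel_prod case_prod_beta')
  \<comment> \<open>Swapped copies put the parameter t first, the order in which measurability of a
    parametric integral is available.\<close>
  have Wp'[measurable]: "(\<lambda>z. W (snd z) (fst z)) \<in> borel_measurable (lborel \<Otimes>\<^sub>M lborel)"
    using measurable_compose[OF measurable_pair_swap' Wp] by (simp add: case_prod_beta')
  have cp'[measurable]: "(\<lambda>z. c (snd z) (fst z)) \<in> borel_measurable (lborel \<Otimes>\<^sub>M lborel)"
    using measurable_compose[OF measurable_pair_swap' cp] by (simp add: case_prod_beta')
  have Wt[measurable]: "(\<lambda>x. W x t) \<in> borel_measurable borel" for t
    using measurable_compose[OF measurable_Pair2'[where y = t] Wp] by simp
  have ct[measurable]: "(\<lambda>x. c x t) \<in> borel_measurable borel" for t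
    using measurable_compose[OF measurable_Pair2'[where y = t] cp] by simp
  have [measurable]: "ball x0 r \<in> sets borel" for r by simp
  \<comment> \<open>Here \<open>a j t\<close> is the spatial norm on the annulus, \<open>E t\<close>
    the weighted energy of the core, and \<open>K j\<close> the constant of the shell
    estimate.\<close>
  define a where "a j t = epow (\<integral>\<^sup>+ y\<in>fixed_annulus \<Gamma> x0 j. ennreal ((norm (W y t))\<^sup>2) \<partial>lborel) (1/2)" for j t
  define E where "E t = (\<integral>\<^sup>+ x\<in>ball x0 (2 * rad k). ennreal (c x t * (norm (W x t))\<^sup>2) \<partial>lborel)" for t
  define K where "K j = annulus_const \<Gamma> / (rad j * sqrt (rad j))" for j
  have ac: "0 \<le> annulus_const \<Gamma>" using \<Gamma> by (simp add: annulus_const_def)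
  have K0: "0 \<le> K j" for j using ac by (simp add: K_def)
  have a_meas[measurable]: "a j \<in> borel_measurable borel" for j
    unfolding a_def by measurable
  have E_meas[measurable]: "E \<in> borel_measurable borel"
    unfolding E_def by measurable
  define A where "A j = (\<integral>\<^sup>+ z\<in>fixed_annulus \<Gamma> x0 j \<times> I.
      (case z of (x, t) \<Rightarrow> ennreal ((norm (W x t))\<^sup>2)) \<partial>lborel)" for j
  have A_slice: "(\<integral>\<^sup>+ t\<in>I. (a j t)\<^sup>2 \<partial>lborel) = A j" for j
  proof -
    have [simp]: "(a j t)\<^sup>2 = (\<integral>\<^sup>+ y\<in>fixed_annulus \<Gamma> x0 j. ennreal ((norm (W y t))\<^sup>2) \<partial>lborel)" for t
      by (simp add: a_def square_esqrt)
    show ?thesis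
      unfolding A_def by (subst nn_integral_lborel_prod_slice) (simp_all add: case_prod_beta')
  qed
  have time_CS: "(\<integral>\<^sup>+ t\<in>I. a j t * E t \<partial>lborel)
      \<le> epow (A j) (1/2) * epow (\<integral>\<^sup>+ t\<in>I. (E t)\<^sup>2 \<partial>lborel) (1/2)" for j
  proof -
    have "(\<integral>\<^sup>+ t\<in>I. a j t * E t \<partial>lborel)
        = (\<integral>\<^sup>+ t. (a j t * indicator I t) * (E t * indicator I t) \<partial>lborel)"
      by (intro nn_integral_cong) (auto split: split_indicator)
    also have "\<dots> \<le> epow (\<integral>\<^sup>+ t. (a j t * indicator I t)\<^sup>2 \<partial>lborel) (1/2)
        * epow (\<integral>\<^sup>+ t. (E t * indicator I t)\<^sup>2 \<partial>lborel) (1/2)"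
      by (rule Cauchy_Schwarz_nn_integral_esqrt) simp_all
    also have "(\<integral>\<^sup>+ t. (a j t * indicator I t)\<^sup>2 \<partial>lborel) = (\<integral>\<^sup>+ t\<in>I. (a j t)\<^sup>2 \<partial>lborel)"
      by (intro nn_integral_cong) (auto split: split_indicator)
    also have "(\<integral>\<^sup>+ t. (E t * indicator I t)\<^sup>2 \<partial>lborel) = (\<integral>\<^sup>+ t\<in>I. (E t)\<^sup>2 \<partial>lborel)"
      by (intro nn_integral_cong) (auto split: split_indicator)
    finally show ?thesis by (simp add: A_slice)
  qed
  \<comment> \<open>Unlike the stretching term it majorises, this function contains no moving shell,
    and its joint measurability is immediate.\<close>
  define F where "F x t = (\<Sum>m\<in>{0..k}. ennreal (K (k - m)) * a (k - m) t)
      * ennreal (c x t * (norm (W x t))\<^sup>2)" for x t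
  have ptw: "ennreal (c x t * max 0 (((\<Sum>m\<in>{0..k}. LINT y:shell \<Gamma> k m x|lebesgue.
           strain_apply (x - y) (W y t)) *v W x t) \<bullet> W x t)) \<le> F x t"
    if "x \<in> ball x0 (rad k)" for x t
    unfolding F_def
    using that \<Gamma> c0 unfolding a_def K_def
    by (intro order_trans[OF stretching_pointwise_le] mult_right_mono sum_mono shell_strain_le) auto
  have F_meas: "case_prod F \<in> borel_measurable borel"
    unfolding F_def by (simp add: case_prod_beta')
  have "(\<integral>\<^sup>+ z\<in>ball x0 (rad k) \<times> I. (case z of (x, t) \<Rightarrow>
         ennreal (c x t * max 0 (((\<Sum>m\<in>{0..k}. LINT y:shell \<Gamma> k m x|lebesgue.
           strain_apply (x - y) (W y t)) *v W x t) \<bullet> W x t))) \<partial>lebesgue)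
      \<le> (\<integral>\<^sup>+ z\<in>ball x0 (rad k) \<times> I. case_prod F z \<partial>lborel)"
    unfolding nn_integral_completion
    using ptw by (intro nn_integral_mono) (auto split: split_indicator)
  also have "\<dots> = (\<integral>\<^sup>+ t\<in>I. (\<integral>\<^sup>+ x\<in>ball x0 (rad k). F x t \<partial>lborel) \<partial>lborel)"
    by (intro nn_integral_lborel_prod_slice F_meas) auto
  also have "\<dots> \<le> (\<integral>\<^sup>+ t. (\<Sum>m\<in>{0..k}. ennreal (K (k - m)) * (a (k - m) t * E t * indicator I t)) \<partial>lborel)"
  proof (intro nn_integral_mono)
    fix t
    have "(\<integral>\<^sup>+ x\<in>ball x0 (rad k). F x t \<partial>lborel)
        = (\<Sum>m\<in>{0..k}. ennreal (K (k - m)) * a (k - m) t)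
          * (\<integral>\<^sup>+ x\<in>ball x0 (rad k). ennreal (c x t * (norm (W x t))\<^sup>2) \<partial>lborel)"
      unfolding F_def mult.assoc by (rule nn_integral_cmult) measurable
    \<comment> \<open>The ball is doubled to match the domain of the core reservoir.\<close>
    also have "\<dots> \<le> (\<Sum>m\<in>{0..k}. ennreal (K (k - m)) * a (k - m) t) * E t"
      unfolding E_def using subset_ball[of "rad k" "2 * rad k" x0]
      by (intro mult_left_mono nn_integral_mono) (auto split: split_indicator)
    finally show "(\<integral>\<^sup>+ x\<in>ball x0 (rad k). F x t \<partial>lborel) * indicator I t
        \<le> (\<Sum>m\<in>{0..k}. ennreal (K (k - m)) * (a (k - m) t * E t * indicator I t))"
      by (auto split: split_indicator simp: sum_distrib_right mult.assoc)
  qed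
  also have "\<dots> = (\<Sum>m\<in>{0..k}. ennreal (K (k - m)) * (\<integral>\<^sup>+ t\<in>I. a (k - m) t * E t \<partial>lborel))"
    by (subst nn_integral_sum) (auto intro!: sum.cong nn_integral_cmult)
  also have "\<dots> \<le> (\<Sum>m\<in>{0..k}. ennreal (K (k - m))
      * (epow (A (k - m)) (1/2) * epow (\<integral>\<^sup>+ t\<in>I. (E t)\<^sup>2 \<partial>lborel) (1/2)))"
    by (intro sum_mono mult_left_mono time_CS) auto
  also have "\<dots> = (\<Sum>j\<in>{0..k}. ennreal (K j)
      * (epow (A j) (1/2) * epow (\<integral>\<^sup>+ t\<in>I. (E t)\<^sup>2 \<partial>lborel) (1/2)))"
    by (rule sum.reindex_bij_witness[where i = "\<lambda>j. k - j" and j = "\<lambda>j. k - j"]) auto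
  finally have "ennreal (rad k) * (\<integral>\<^sup>+ z\<in>ball x0 (rad k) \<times> I. (case z of (x, t) \<Rightarrow>
         ennreal (c x t * max 0 (((\<Sum>m\<in>{0..k}. LINT y:shell \<Gamma> k m x|lebesgue.
           strain_apply (x - y) (W y t)) *v W x t) \<bullet> W x t))) \<partial>lebesgue)
      \<le> (\<Sum>j\<in>{0..k}. ennreal (rad k) * (ennreal (K j)
      * (epow (A j) (1/2) * epow (\<integral>\<^sup>+ t\<in>I. (E t)\<^sup>2 \<partial>lborel) (1/2))))"
    unfolding sum_distrib_left[symmetric] by (rule mult_left_mono) simp
  also have "\<dots> = (\<Sum>j\<in>{0..k}. ennreal (annulus_const \<Gamma>) * (ennreal ((1/2) ^ (k - j))
      * epow (ennreal (1 / rad j) * A j) (1/2) * epow (\<integral>\<^sup>+ t\<in>I. (E t)\<^sup>2 \<partial>lborel) (1/2)))"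
  proof (intro sum.cong refl)
    fix j assume "j \<in> {0..k}"
    then have "rad k = (1/2) ^ (k - j) * rad j"
      by (simp add: rad_def flip: power_add)
    \<comment> \<open>One of the three half powers of r_j in the denominator of \<open>K j\<close>
      remains; it enters the root as the normalisation 1 / r_j of the reservoir.\<close>
    moreover have "rad j * K j = annulus_const \<Gamma> * sqrt (1 / rad j)"
      using rad_pos[of j] by (simp add: K_def real_sqrt_divide)
    ultimately have "rad k * K j = annulus_const \<Gamma> * ((1/2) ^ (k - j) * sqrt (1 / rad j))"
      by (simp add: mult.assoc mult.left_commute)
    then have "ennreal (rad k) * ennreal (K j)
        = ennreal (annulus_const \<Gamma>) * (ennreal ((1/2) ^ (k - j)) * epow (ennreal (1 / rad j)) (1/2))"
      using ac K0 by (simp add: epow_ennreal powr_half_sqrt flip: ennreal_mult)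
    then have "ennreal (rad k) * ennreal (K j) * (X * Y)
        = ennreal (annulus_const \<Gamma>) * (ennreal ((1/2) ^ (k - j)) * epow (ennreal (1 / rad j)) (1/2)) * (X * Y)" for X Y
      by simp
    then show "ennreal (rad k) * (ennreal (K j)
          * (epow (A j) (1/2) * epow (\<integral>\<^sup>+ t\<in>I. (E t)\<^sup>2 \<partial>lborel) (1/2)))
        = ennreal (annulus_const \<Gamma>) * (ennreal ((1/2) ^ (k - j))
          * epow (ennreal (1 / rad j) * A j) (1/2) * epow (\<integral>\<^sup>+ t\<in>I. (E t)\<^sup>2 \<partial>lborel) (1/2))"
      by (simp add: epow_mult mult.assoc)
  qed
  finally show ?thesis
    unfolding A_def E_def I_def nn_integral_completion sum_distrib_left[symmetric] .
qed

subsection \<open>Differentiation of convolutions\<close>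

text \<open>As a vector representing the derivative, the gradient turns continuity of partial
  derivatives into continuity of one map, and Cauchy-Schwarz bounds operator norms of
  differences.\<close>

definition grad :: "('a::euclidean_space \<Rightarrow> real) \<Rightarrow> 'a \<Rightarrow> 'a"
  where "grad g z = (\<Sum>b\<in>Basis. dir_deriv b g z *\<^sub>R b)"

lemma inner_grad:
  assumes "g differentiable at z"
  shows "grad g z \<bullet> h = frechet_derivative g (at z) h"
proof -
  have lin: "linear (frechet_derivative g (at z))"
    using assms by (simp add: linear_frechet_derivative)
  have "frechet_derivative g (at z) h = frechet_derivative g (at z) (\<Sum>b\<in>Basis. (h \<bullet> b) *\<^sub>R b)"
    by (simp add: euclidean_representation)
  also have "\<dots> = (\<Sum>b\<in>Basis. (h \<bullet> b) * frechet_derivative g (at z) b)"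
    by (simp add: linear_sum[OF lin] linear_scale[OF lin])
  also have "\<dots> = grad g z \<bullet> h"
    by (simp add: grad_def dir_deriv_def inner_sum_left) (simp add: inner_commute mult.commute)
  finally show ?thesis by simp
qed

lemma has_derivative_grad:
  assumes "Ck (Suc 0) g"
  shows "(g has_derivative (\<lambda>h. grad g z \<bullet> h)) (at z)"
  using assms by (simp add: inner_grad frechet_derivative_works[symmetric])

lemma continuous_grad:
  fixes g :: "'a::euclidean_space \<Rightarrow> real"
  assumes "Ck (Suc 0) g"
  shows "continuous_on UNIV (grad g)"
  unfolding grad_def using assms by (intro continuous_intros) simp

lemma continuous_Ck1:
  assumes "Ck (Suc 0) g"
  shows "continuous_on UNIV g"
  using assms by (auto simp: continuous_on_eq_continuous_at differentiable_imp_continuous_within)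

lemma grad_eq_0:
  fixes g :: "'a::euclidean_space \<Rightarrow> real"
  assumes "\<And>z. R < norm z \<Longrightarrow> g z = 0" "R < norm z"
  shows "grad g z = 0"
proof -
  have "open {z::'a. R < norm z}"
    by (intro open_Collect_less continuous_intros)
  then have "(g has_derivative (\<lambda>h. 0)) (at z)"
    by (rule has_derivative_transform_within_open[OF has_derivative_const]) (simp_all add: assms)
  then have "frechet_derivative g (at z) = (\<lambda>h. 0)"
    by (metis frechet_derivative_at)
  then show ?thesis by (simp add: grad_def dir_deriv_def)
qed

text \<open>Compactness is used on a ball one unit larger than the support. Points at distance below
  1 either both lie in it or both lie where G vanishes.\<close>

lemma compact_support_uniformly_continuous:
  fixes G :: "'a::euclidean_space \<Rightarrow> 'b::real_normed_vector"
  assumes "continuous_on UNIV G" and G0: "\<And>z. R < norm z \<Longrightarrow> G z = 0" and "0 < e"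
  obtains d where "0 < d" "\<And>z z'. dist z z' < d \<Longrightarrow> dist (G z) (G z') < e"
proof -
  have "uniformly_continuous_on (cball 0 (R + 1)) G"
    using assms by (intro compact_uniformly_continuous) (auto intro: continuous_on_subset)
  then obtain d where d: "0 < d"
      "\<And>z z'. z \<in> cball 0 (R + 1) \<Longrightarrow> z' \<in> cball 0 (R + 1) \<Longrightarrow> dist z z' < d \<Longrightarrow> dist (G z) (G z') < e"
    using \<open>0 < e\<close> unfolding uniformly_continuous_on_def by (metis dist_commute)
  show ?thesis
  proof
    show "0 < min d 1" using d by simp
    fix z z' :: 'a assume zz: "dist z z' < min d 1"
    have "\<bar>norm z - norm z'\<bar> < 1"
      using zz norm_triangle_ineq3[of z z'] by (simp add: dist_norm)
    then consider "norm z \<le> R + 1" "norm z' \<le> R + 1" | "R < norm z" "R < norm z'"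
      by linarith
    then show "dist (G z) (G z') < e"
      using d(2)[of z z'] zz G0 \<open>0 < e\<close> by cases auto
  qed
qed

lemma compact_support_bounded:
  fixes G :: "'a::euclidean_space \<Rightarrow> 'b::real_normed_vector"
  assumes "continuous_on UNIV G" "\<And>z. R < norm z \<Longrightarrow> G z = 0"
  obtains M where "0 \<le> M" "\<And>z. norm (G z) \<le> M"
proof -
  have "bounded (G ` cball 0 R)"
    using assms by (intro compact_imp_bounded compact_continuous_image) (auto intro: continuous_on_subset)
  then obtain M where M: "0 < M" "\<forall>z\<in>cball 0 R. norm (G z) \<le> M"
    by (auto simp: bounded_pos)
  have "norm (G z) \<le> M" for z
    using M assms(2)[of z] by (cases "norm z \<le> R") auto
  with M show ?thesis by (intro that[of M]) auto
qed

section \<open>Convolution of locally integrable fields with compactly supported kernels\<close>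

definition locally_integrable :: "('a::euclidean_space \<Rightarrow> 'b::euclidean_space) \<Rightarrow> bool"
  where "locally_integrable f \<longleftrightarrow> f \<in> borel_measurable borel \<and>
    (\<forall>r. integrable lborel (\<lambda>y. indicator (cball 0 r) y *\<^sub>R f y))"

text \<open>On a bounded set this follows from |v| \<le> 1 + |v|^2.\<close>

lemma locally_integrable_square:
  fixes f :: "'a::euclidean_space \<Rightarrow> 'b::euclidean_space"
  assumes [measurable]: "f \<in> borel_measurable borel"
    and fin: "(\<integral>\<^sup>+ x. ennreal ((norm (f x))\<^sup>2) \<partial>lborel) < \<infinity>"
  shows "locally_integrable f"
  unfolding locally_integrable_def
proof (intro conjI allI)
  fix r :: real
  show "integrable lborel (\<lambda>y. indicator (cball 0 r) y *\<^sub>R f y)"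
  proof (rule integrableI_bounded)
    have le: "norm v \<le> 1 + (norm v)\<^sup>2" for v :: 'b
      using zero_le_power2[of "norm v - 1"] zero_le_power2[of "norm v"]
      unfolding power2_diff one_power2 mult_1_right by linarith
    have "(\<integral>\<^sup>+ y. ennreal (norm (indicator (cball 0 r) y *\<^sub>R f y)) \<partial>lborel)
        \<le> (\<integral>\<^sup>+ y. indicator (cball 0 r) y + ennreal ((norm (f y))\<^sup>2) \<partial>lborel)"
      using le by (intro nn_integral_mono) (auto split: split_indicator simp flip: ennreal_plus ennreal_1)
    also have "\<dots> = emeasure lborel (cball (0::'a) r) + (\<integral>\<^sup>+ y. ennreal ((norm (f y))\<^sup>2) \<partial>lborel)"
      by (subst nn_integral_add) (auto intro!: borel_measurable_indicator)
    also have "\<dots> < \<infinity>"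
      using fin emeasure_bounded_finite[of "cball (0::'a) r"] by (simp add: less_top)
    finally show "(\<integral>\<^sup>+ y. ennreal (norm (indicator (cball 0 r) y *\<^sub>R f y)) \<partial>lborel) < \<infinity>" .
  qed (auto intro!: borel_measurable_scaleR borel_measurable_indicator)
qed simp

text \<open>The support of k confines y to |y| \<le> |x| + R, where k is bounded and f is
  integrable.\<close>

lemma integrable_convolution:
  fixes f :: "'a::euclidean_space \<Rightarrow> 'b::euclidean_space" and k :: "'a \<Rightarrow> real"
  assumes f: "locally_integrable f" and k: "continuous_on UNIV k" "\<And>z. R < norm z \<Longrightarrow> k z = 0"
  shows "integrable lborel (\<lambda>y. k (x - y) *\<^sub>R f y)"
proof -
  have [measurable]: "f \<in> borel_measurable borel" "k \<in> borel_measurable borel"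
    using f k by (auto simp: locally_integrable_def intro: borel_measurable_continuous_onI)
  obtain M where M: "0 \<le> M" "\<And>z. norm (k z) \<le> M"
    using compact_support_bounded[OF k] by metis
  show ?thesis
  proof (rule Bochner_Integration.integrable_bound)
    show "integrable lborel (\<lambda>y. M *\<^sub>R (indicator (cball 0 (norm x + R)) y *\<^sub>R f y))"
      using f by (intro integrable_scaleR_right) (simp add: locally_integrable_def)
    have "norm (k (x - y) *\<^sub>R f y) \<le> norm (M *\<^sub>R (indicator (cball 0 (norm x + R)) y *\<^sub>R f y))" for y
    proof (cases "norm (x - y) \<le> R")
      case True
      then have "norm y \<le> norm x + R"
        using norm_triangle_ineq4[of x "x - y"] by simp
      then show ?thesis
        using M by (simp add: mult_right_mono)
    qed (use k(2)[of "x - y"] in simp)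
    then show "AE y in lborel. norm (k (x - y) *\<^sub>R f y) \<le> norm (M *\<^sub>R (indicator (cball 0 (norm x + R)) y *\<^sub>R f y))"
      by simp
  qed measurable
qed

text \<open>The gradient of g is uniformly continuous, so the linearisation error of g is small
  relative to h uniformly in the base point. Integrated against f over one fixed ball, the error
  stays small relative to h.\<close>

lemma has_derivative_convolution:
  fixes f :: "'a::euclidean_space \<Rightarrow> 'b::euclidean_space" and g :: "'a \<Rightarrow> real"
  assumes f: "locally_integrable f" and g: "Ck (Suc 0) g" "\<And>z. R < norm z \<Longrightarrow> g z = 0"
  shows "((\<lambda>x. LINT y|lborel. g (x - y) *\<^sub>R f y) has_derivative
    (\<lambda>h. \<Sum>b\<in>Basis. (h \<bullet> b) *\<^sub>R (LINT y|lborel. dir_deriv b g (x - y) *\<^sub>R f y))) (at x)"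
proof -
  let ?F = "\<lambda>x. LINT y|lborel. g (x - y) *\<^sub>R f y"
  let ?D = "\<lambda>h. \<Sum>b\<in>Basis. (h \<bullet> b) *\<^sub>R (LINT y|lborel. dir_deriv b g (x - y) *\<^sub>R f y)"
  have g0: "grad g z = 0" if "R < norm z" for z
    using grad_eq_0[of R g z] g(2) that by blast
  have grad_b: "grad g z \<bullet> b = dir_deriv b g z" for z b
    using g(1) by (simp add: inner_grad dir_deriv_def)
  have int_b: "integrable lborel (\<lambda>y. dir_deriv b g (x - y) *\<^sub>R f y)" if "b \<in> Basis" for b
    using g(1) that g0
    by (intro integrable_convolution[OF f, where R = R]) (auto simp: grad_b[symmetric])
  have int_g: "integrable lborel (\<lambda>y. g (x - y) *\<^sub>R f y)" for x
    using g by (intro integrable_convolution[OF f] continuous_Ck1)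
  have D_eq: "?D h = (LINT y|lborel. (grad g (x - y) \<bullet> h) *\<^sub>R f y)"
    and int_D: "integrable lborel (\<lambda>y. (grad g (x - y) \<bullet> h) *\<^sub>R f y)" for h
  proof -
    have *: "(grad g z \<bullet> h) *\<^sub>R v = (\<Sum>b\<in>Basis. (h \<bullet> b) *\<^sub>R (dir_deriv b g z *\<^sub>R v))" for z and v :: 'b
      by (subst euclidean_inner) (simp add: grad_b mult.commute scaleR_sum_left)
    show "integrable lborel (\<lambda>y. (grad g (x - y) \<bullet> h) *\<^sub>R f y)"
      unfolding * using int_b by (intro Bochner_Integration.integrable_sum integrable_scaleR_right)
    show "?D h = (LINT y|lborel. (grad g (x - y) \<bullet> h) *\<^sub>R f y)"
      unfolding * using int_b
      by (subst Bochner_Integration.integral_sum) (simp_all only: integrable_scaleR_right integral_scaleR_right)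
  qed
  \<comment> \<open>The extra 1 leaves room for moving x: if |x' - x| < 1 and |y| > r, then both x -
    y and x' - y lie outside the ball of radius R, and the whole remainder vanishes.\<close>
  define r where "r = norm x + R + 1"
  define J where "J = (LINT y|lborel. norm (indicator (cball 0 r) y *\<^sub>R f y))"
  have int_r: "integrable lborel (\<lambda>y. indicator (cball 0 r) y *\<^sub>R f y)"
    using f by (simp add: locally_integrable_def)
  have J: "0 \<le> J" unfolding J_def by (intro integral_nonneg_AE) simp
  show ?thesis
    unfolding has_derivative_at_alt
  proof (intro conjI allI impI)
    show "bounded_linear ?D"
      by (intro bounded_linear_sum bounded_linear_scaleR_const bounded_linear_inner_left bounded_linear_ident)
    fix e :: real assume e: "0 < e"
    \<comment> \<open>Integration will multiply the tolerance by J; dividing by J + 1 rather than J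
      covers the case J = 0.\<close>
    then have "0 < e / (J + 1)" using J by simp
    then obtain d where d: "0 < d" "\<And>z z'. dist z z' < d \<Longrightarrow> dist (grad g z) (grad g z') < e / (J + 1)"
      using compact_support_uniformly_continuous[OF continuous_grad[OF g(1)], of R] g0 by metis
    \<comment> \<open>The mean value inequality on the ball of radius d about z bounds the error by
      the oscillation of the gradient there; one d serves all z.\<close>
    have rem: "norm (g (z + h) - g z - grad g z \<bullet> h) \<le> norm h * (e / (J + 1))" if h: "norm h < d" for z h
    proof -
      have "norm (g (z + h) - g z - grad g z \<bullet> (z + h - z)) \<le> norm (z + h - z) * (e / (J + 1))"
      proof (rule differentiable_bound_linearization[where S = "ball z d" and f' = "\<lambda>w h. grad g w \<bullet> h"])
        show "z + t *\<^sub>R (z + h - z) \<in> ball z d" if "t \<in> {0..1}" for t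
        proof -
          have "t * norm h \<le> 1 * norm h" using that by (intro mult_right_mono) auto
          then show ?thesis using h that by (simp add: dist_norm)
        qed
        show "(g has_derivative (\<lambda>h. grad g w \<bullet> h)) (at w within ball z d)" for w
          by (rule has_derivative_at_withinI[OF has_derivative_grad[OF g(1)]])
        fix w assume w: "w \<in> ball z d"
        have "onorm (\<lambda>h. (grad g w - grad g z) \<bullet> h) \<le> norm (grad g w - grad g z)"
          by (rule onorm_bound) (auto simp: Cauchy_Schwarz_ineq2)
        also have "\<dots> \<le> e / (J + 1)"
          using d(2)[of w z] w by (simp add: dist_norm norm_minus_commute)
        finally show "onorm ((\<lambda>h. grad g w \<bullet> h) - (\<lambda>h. grad g z \<bullet> h)) \<le> e / (J + 1)"
          by (simp add: fun_diff_def inner_diff_left)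
      qed (use d in auto)
      then show ?thesis by simp
    qed
    show "\<exists>d>0. \<forall>y. norm (y - x) < d \<longrightarrow> norm (?F y - ?F x - ?D (y - x)) \<le> e * norm (y - x)"
    proof (intro exI[of _ "min d 1"] conjI allI impI)
      show "0 < min d 1" using d by simp
      fix x' assume x': "norm (x' - x) < min d 1"
      define h where "h = x' - x"
      let ?\<rho> = "\<lambda>y. g (x' - y) - g (x - y) - grad g (x - y) \<bullet> h"
      have bound: "norm (?\<rho> y *\<^sub>R f y) \<le> norm h * (e / (J + 1)) * norm (indicator (cball 0 r) y *\<^sub>R f y)" for y
      proof (cases "norm y \<le> r")
        case True
        have "\<bar>?\<rho> y\<bar> \<le> norm h * (e / (J + 1))"
          using rem[of h "x - y"] x' by (simp add: h_def algebra_simps)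
        then have "\<bar>?\<rho> y\<bar> * norm (f y) \<le> norm h * (e / (J + 1)) * norm (f y)"
          by (rule mult_right_mono) simp
        then show ?thesis using True by simp
      next
        case False
        have "norm y \<le> norm (x - y) + norm x"
          using norm_triangle_ineq4[of x "x - y"] by simp
        moreover have "norm (x - y) \<le> norm (x' - y) + norm (x' - x)"
          using norm_triangle_ineq4[of "x' - y" "x' - x"] by simp
        ultimately have "R < norm (x - y)" "R < norm (x' - y)"
          using False x' by (simp_all add: r_def)
        then show ?thesis using g(2) g0 False by simp
      qed
      have "?F x' - ?F x - ?D h = (LINT y|lborel. ?\<rho> y *\<^sub>R f y)"
        unfolding D_eq using int_g int_D
        by (simp add: scaleR_diff_left)
      also have "norm \<dots> \<le> (LINT y|lborel. norm h * (e / (J + 1)) * norm (indicator (cball 0 r) y *\<^sub>R f y))"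
        using int_r int_g int_D bound
        by (intro Bochner_Integration.integral_norm_bound_integral integrable_mult_right integrable_norm)
           (simp_all add: scaleR_diff_left)
      also have "\<dots> = norm h * (e / (J + 1)) * J"
        unfolding J_def by (rule integral_mult_right_zero)
      also have "\<dots> \<le> e * norm h"
        using J e by (simp add: field_simps mult_left_mono)
      finally show "norm (?F x' - ?F x - ?D (x' - x)) \<le> e * norm (x' - x)"
        by (simp add: h_def)
    qed
  qed
qed

lemma dir_deriv_convolution:
  fixes f :: "'a::euclidean_space \<Rightarrow> 'b::euclidean_space" and g :: "'a \<Rightarrow> real"
  assumes "locally_integrable f" "Ck (Suc 0) g" "\<And>z. R < norm z \<Longrightarrow> g z = 0" and b: "b \<in> Basis"
  shows "dir_deriv b (\<lambda>x. LINT y|lborel. g (x - y) *\<^sub>R f y) x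
    = (LINT y|lborel. dir_deriv b g (x - y) *\<^sub>R f y)"
proof -
  have "dir_deriv b (\<lambda>x. LINT y|lborel. g (x - y) *\<^sub>R f y) x
      = (\<Sum>b'\<in>Basis. (b \<bullet> b') *\<^sub>R (LINT y|lborel. dir_deriv b' g (x - y) *\<^sub>R f y))"
    unfolding dir_deriv_def
    by (subst frechet_derivative_at[OF has_derivative_convolution[OF assms(1-3)], symmetric])
       (simp_all add: dir_deriv_def)
  also have "\<dots> = (\<Sum>b'\<in>Basis. if b' = b then LINT y|lborel. dir_deriv b' g (x - y) *\<^sub>R f y else 0)"
    using b by (intro sum.cong) (auto simp: inner_Basis)
  also have "\<dots> = (LINT y|lborel. dir_deriv b g (x - y) *\<^sub>R f y)"
    using b by simp
  finally show ?thesis .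
qed


section \<open>Rescaled mollifiers and the vorticity as a convolution\<close>

lemma dir_deriv_mollifier:
  assumes "0 < l" "Ck (Suc 0) \<phi>"
  shows "mollifier \<phi> l differentiable at x"
    and "dir_deriv b (mollifier \<phi> l) x = dir_deriv b \<phi> (x /\<^sub>R l) / l ^ 4"
proof -
  have "(mollifier \<phi> l has_derivative (\<lambda>h. grad \<phi> (x /\<^sub>R l) \<bullet> (h /\<^sub>R l) / l ^ 3)) (at x)"
    unfolding mollifier_def using assms
    by (auto intro!: derivative_eq_intros has_derivative_compose[OF _ has_derivative_grad[OF assms(2)]]
        simp: divide_inverse)
  note d = this
  show "mollifier \<phi> l differentiable at x"
    using d by (rule differentiableI)
  have "dir_deriv b (mollifier \<phi> l) x = grad \<phi> (x /\<^sub>R l) \<bullet> (b /\<^sub>R l) / l ^ 3"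
    unfolding dir_deriv_def by (simp flip: frechet_derivative_at[OF d])
  then show "dir_deriv b (mollifier \<phi> l) x = dir_deriv b \<phi> (x /\<^sub>R l) / l ^ 4"
    using assms by (simp add: inner_grad dir_deriv_def field_simps power_numeral_reduce)
qed

lemma Ck1_mollifier:
  assumes "0 < l" "Ck (Suc 0) \<phi>"
  shows "Ck (Suc 0) (mollifier \<phi> l)"
proof -
  have "continuous_on UNIV (dir_deriv b (mollifier \<phi> l))" if "b \<in> Basis" for b
  proof -
    have cont: "continuous_on UNIV (dir_deriv b \<phi>)"
      using assms that by simp
    have "continuous_on UNIV (\<lambda>x. dir_deriv b \<phi> (x /\<^sub>R l))"
      by (rule continuous_on_compose2[OF cont]) (auto intro!: continuous_intros)
    then have "continuous_on UNIV (\<lambda>x. dir_deriv b \<phi> (x /\<^sub>R l) / l ^ 4)"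
      using assms by (intro continuous_intros) auto
    then show ?thesis
      by (simp flip: dir_deriv_mollifier(2)[OF assms])
  qed
  then show ?thesis
    using dir_deriv_mollifier(1)[OF assms] by simp
qed

text \<open>All derivatives fall on the mollifier, which replaces the choice in
  \<open>frechet_derivative\<close> by a parametric integral that is visibly measurable in x and t
  together.\<close>

lemma vort_eq_convolution:
  assumes \<phi>: "Ck (Suc 0) \<phi>" "\<And>z. 1 < norm z \<Longrightarrow> \<phi> z = 0" and \<sigma>: "0 < \<sigma>"
    and v: "locally_integrable (\<lambda>y. v y t)"
  shows "vort \<sigma> \<phi> v k x t = (\<chi> i. \<Sum>j\<in>UNIV. \<Sum>m\<in>UNIV. levi_civita i j m *
    (LINT y|lborel. dir_deriv (axis j 1) (mollifier \<phi> (\<sigma> * rad k)) (x - y) *\<^sub>R v y t) $ m)"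
proof -
  define l where "l = \<sigma> * rad k"
  have l: "0 < l" using \<sigma> by (simp add: l_def)
  have supp: "mollifier \<phi> l z = 0" if "l < norm z" for z
    using that l \<phi>(2)[of "z /\<^sub>R l"] by (simp add: mollifier_def field_simps)
  have g: "Ck (Suc 0) (mollifier \<phi> l)"
    using l \<phi> by (intro Ck1_mollifier)
  have [measurable]: "mollifier \<phi> l \<in> borel_measurable borel" "(\<lambda>y. v y t) \<in> borel_measurable borel"
    using continuous_Ck1[OF g] v
    by (auto simp: locally_integrable_def intro: borel_measurable_continuous_onI)
  have "mollify \<phi> l (\<lambda>y. v y t) = (\<lambda>x. LINT y|lborel. mollifier \<phi> l (x - y) *\<^sub>R v y t)"
    unfolding mollify_def by (intro ext integral_completion) measurable
  moreover have "axis j 1 \<in> (Basis :: (real^3) set)" for j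
    by (simp add: axis_in_Basis_iff)
  ultimately show ?thesis
    unfolding vort_def curl_def l_def[symmetric]
    using dir_deriv_convolution[OF v g supp] by simp
qed

subsection \<open>Borel representative of the vorticity\<close>

lemma fst_borel_measurable: "(fst :: 'a::second_countable_topology \<times> 'b::second_countable_topology \<Rightarrow> 'a) \<in> borel_measurable borel"
  and snd_borel_measurable: "(snd :: 'a \<times> 'b \<Rightarrow> 'b) \<in> borel_measurable borel"
  by (intro borel_measurable_continuous_onI continuous_intros)+

text \<open>The pair (x, t) is treated as a single parameter, and measurability of parametric
  integrals applies once y is moved into the space slot of v.\<close>

lemma borel_measurable_convolution_slices:
  fixes v :: "'a::euclidean_space \<Rightarrow> real \<Rightarrow> 'b::euclidean_space"
  assumes v: "case_prod v \<in> borel_measurable borel" and k: "k \<in> borel_measurable borel"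
  shows "(\<lambda>z. LINT y|lborel. k (fst z - y) *\<^sub>R v y (snd z)) \<in> borel_measurable borel"
proof -
  note [measurable] = fst_borel_measurable snd_borel_measurable k
  have "(\<lambda>w. (snd w, snd (fst w))) \<in> (borel :: ('a \<times> real) measure) \<Otimes>\<^sub>M (lborel :: 'a measure) \<rightarrow>\<^sub>M borel \<Otimes>\<^sub>M borel"
    by measurable
  then have "(\<lambda>w. case_prod v (snd w, snd (fst w))) \<in> borel_measurable ((borel :: ('a \<times> real) measure) \<Otimes>\<^sub>M lborel)"
    using v unfolding borel_prod by (rule measurable_compose)
  then have [measurable]: "(\<lambda>w. v (snd w) (snd (fst w))) \<in> borel_measurable ((borel :: ('a \<times> real) measure) \<Otimes>\<^sub>M lborel)"
    by simp
  show ?thesis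
    by (rule lborel.borel_measurable_lebesgue_integral) (simp add: case_prod_beta')
qed

lemma borel_measurable_vec_nth: "(\<lambda>x::real^'n. x $ i) \<in> borel_measurable borel"
  by (intro borel_measurable_continuous_onI continuous_intros)

lemma borel_measurable_vec_lambda:
  assumes "\<And>i. f i \<in> borel_measurable M"
  shows "(\<lambda>z. (\<chi> i. f i z) :: real^'n) \<in> borel_measurable M"
  using assms by (subst borel_measurable_euclidean_space) (auto simp: Basis_vec_def inner_axis)

lemma borel_measurable_vort:
  assumes \<phi>: "Ck (Suc 0) \<phi>" "\<And>z. 1 < norm z \<Longrightarrow> \<phi> z = 0" and \<sigma>: "0 < \<sigma>"
    and v: "case_prod v \<in> borel_measurable borel" "\<And>t. locally_integrable (\<lambda>y. v y t)"
  shows "(\<lambda>(x, t). vort \<sigma> \<phi> v k x t) \<in> borel_measurable borel"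
proof -
  have "dir_deriv (axis j 1) (mollifier \<phi> (\<sigma> * rad k)) \<in> borel_measurable borel" for j
    using Ck1_mollifier[OF _ \<phi>(1), of "\<sigma> * rad k"] \<sigma>
    by (intro borel_measurable_continuous_onI) (simp add: axis_in_Basis_iff)
  note [measurable] = borel_measurable_convolution_slices[OF v(1) this] borel_measurable_vec_nth
  have eq: "vort \<sigma> \<phi> v k x t = (\<chi> i. \<Sum>j\<in>UNIV. \<Sum>m\<in>UNIV. levi_civita i j m *
      (LINT y|lborel. dir_deriv (axis j 1) (mollifier \<phi> (\<sigma> * rad k)) (x - y) *\<^sub>R v y t) $ m)" for x t
    by (intro vort_eq_convolution \<phi> \<sigma> v(2))
  show ?thesis
    unfolding eq case_prod_beta'
    by (rule borel_measurable_vec_lambda) measurable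
qed

text \<open>The scalar result is applied to each component; there are finitely many exceptional
  sets.\<close>

lemma completion_ex_borel_measurable_vec:
  fixes f :: "'a \<Rightarrow> real^'n"
  assumes "f \<in> borel_measurable (completion M)"
  shows "\<exists>g\<in>borel_measurable M. AE x in M. f x = g x"
proof -
  have "\<exists>g\<in>borel_measurable M. AE x in M. f x $ i = g x" for i
    by (rule completion_ex_borel_measurable_real[OF measurable_compose[OF assms borel_measurable_vec_nth]])
  then obtain g where g: "\<And>i. g i \<in> borel_measurable M" "\<And>i. AE x in M. f x $ i = g i x"
    by metis
  have "AE x in M. \<forall>i\<in>UNIV. f x $ i = g i x"
    using g by (intro AE_finite_allI) auto
  then have "AE x in M. f x = (\<chi> i. g i x)"
    by (rule AE_mp) (auto simp: vec_eq_iff)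
  with g(1) show ?thesis
    by (intro bexI[of _ "\<lambda>x. \<chi> i. g i x"] borel_measurable_vec_lambda)
qed

text \<open>Slicing is available with the first variable outermost, and exchanging the order
  requires a measurable predicate. Hence P is first replaced by avoidance of a measurable null
  set.\<close>

lemma AE_lborel_prod_slices:
  fixes P :: "'a::euclidean_space \<times> 'b::euclidean_space \<Rightarrow> bool"
  assumes "AE z in lborel. P z"
  shows "AE t in lborel. AE x in lborel. P (x, t)"
proof -
  obtain N where N: "{z. \<not> P z} \<subseteq> N" "N \<in> null_sets (lborel \<Otimes>\<^sub>M lborel)"
    using assms by (auto simp: eventually_ae_filter lborel_prod)
  then have "AE z in lborel \<Otimes>\<^sub>M lborel. z \<notin> N"
    by (intro AE_not_in)
  then have "AE x in lborel. AE t in lborel. (x, t) \<notin> N"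
    by (rule lborel_pair.AE_pair)
  moreover have "{z \<in> space (lborel \<Otimes>\<^sub>M lborel). (fst z, snd z) \<notin> N} \<in> sets (lborel \<Otimes>\<^sub>M lborel)"
  proof -
    have "{z \<in> space (lborel \<Otimes>\<^sub>M lborel). (fst z, snd z) \<notin> N} = space (lborel \<Otimes>\<^sub>M lborel) - N"
      by auto
    then show ?thesis
      using sets.compl_sets[OF null_setsD2[OF N(2)]] by (simp only:)
  qed
  ultimately have "AE t in lborel. AE x in lborel. (x, t) \<notin> N"
    by (subst (asm) lborel_pair.AE_commute)
  then show ?thesis
    using N(1) by (auto elim!: eventually_mono)
qed

lemma AE_snd_lborel:
  assumes "AE t in lborel. Q t"
  shows "AE z in (lborel :: ('a::euclidean_space \<times> 'b::euclidean_space) measure). Q (snd z)"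
proof -
  obtain N where N: "{t. \<not> Q t} \<subseteq> N" "N \<in> null_sets lborel"
    using assms by (auto simp: eventually_ae_filter)
  then have "emeasure (lborel \<Otimes>\<^sub>M lborel) ((UNIV :: 'a set) \<times> N) = 0"
    by (subst lborel.emeasure_pair_measure_Times) auto
  then have "(UNIV :: 'a set) \<times> N \<in> null_sets lborel"
    using N unfolding lborel_prod[symmetric] by (auto intro!: null_setsI)
  then show ?thesis
    by (rule AE_I') (use N in auto)
qed

text \<open>Square integrability is wanted at every time, not merely at almost every one, so that
  convolutions with v are meaningful for all t and their formula defines a Borel function without
  exceptional times.\<close>

lemma Borel_representative:
  fixes u :: "real^3 \<Rightarrow> real \<Rightarrow> real^3"
  assumes meas: "(\<lambda>(x, t). u x t) \<in> borel_measurable (lebesgue_on (UNIV \<times> T))"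
    and T: "T \<in> sets borel"
    and sq: "AE t in lebesgue_on T. square_integrable (\<lambda>x. u x t)"
  obtains v where "case_prod v \<in> borel_measurable borel"
    and "\<And>t. (\<integral>\<^sup>+ x. ennreal ((norm (v x t))\<^sup>2) \<partial>lborel) < \<infinity>"
    and "AE t in lborel. t \<in> T \<longrightarrow>
      (\<lambda>x. u x t) \<in> borel_measurable lebesgue \<and> (AE x in lborel. u x t = v x t)"
proof -
  have UT: "(UNIV :: (real^3) set) \<times> T \<in> sets borel"
    using T unfolding borel_prod[symmetric] by (intro pair_measureI) auto
  \<comment> \<open>Extension by zero beyond T trades the restricted measure for the full
    one.\<close>
  have "(\<lambda>z. indicator (UNIV \<times> T) z *\<^sub>R (case z of (x, t) \<Rightarrow> u x t)) \<in> borel_measurable lebesgue"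
    using meas UT by (subst (asm) borel_measurable_restrict_space_iff) auto
  then obtain w where w: "w \<in> borel_measurable lborel"
      "AE z in lborel. indicator (UNIV \<times> T) z *\<^sub>R (case z of (x, t) \<Rightarrow> u x t) = w z"
    using completion_ex_borel_measurable_vec by blast
  have uw: "AE t in lborel. t \<in> T \<longrightarrow> (AE x in lborel. u x t = w (x, t))"
    using AE_lborel_prod_slices[OF w(2)] by (rule eventually_mono) auto
  have sq': "AE t in lborel. t \<in> T \<longrightarrow> square_integrable (\<lambda>x. u x t)"
    using sq T by (subst (asm) AE_restrict_space_iff) (auto simp: AE_completion_iff)
  define E where "E t = (\<integral>\<^sup>+ x. ennreal ((norm (w (x, t)))\<^sup>2) \<partial>lborel)" for t
  \<comment> \<open>Slices of infinite energy are erased. The set of such times is Borel because E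
    is, so joint measurability survives.\<close>
  define v where "v x t = (if E t < \<infinity> then w (x, t) else 0)" for x t
  have wp[measurable]: "w \<in> borel_measurable (lborel \<Otimes>\<^sub>M lborel)"
    using w(1) by (simp add: lborel_prod)
  have wp'[measurable]: "(\<lambda>z. w (snd z, fst z)) \<in> borel_measurable (lborel \<Otimes>\<^sub>M lborel)"
    using measurable_compose[OF measurable_pair_swap' wp] by (simp add: case_prod_beta')
  have [measurable]: "E \<in> borel_measurable lborel"
    unfolding E_def by measurable
  have "case_prod v \<in> borel_measurable (lborel \<Otimes>\<^sub>M lborel)"
    unfolding v_def by (simp add: case_prod_beta')
  then have v1: "case_prod v \<in> borel_measurable borel"
    by (simp add: lborel_prod)
  have v2: "(\<integral>\<^sup>+ x. ennreal ((norm (v x t))\<^sup>2) \<partial>lborel) < \<infinity>" for t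
    by (cases "E t < \<infinity>") (auto simp: v_def E_def)
  have v3: "AE t in lborel. t \<in> T \<longrightarrow>
      (\<lambda>x. u x t) \<in> borel_measurable lebesgue \<and> (AE x in lborel. u x t = v x t)"
    using uw sq'
  proof eventually_elim
    case (elim t)
    show ?case
    proof
      assume t: "t \<in> T"
      \<comment> \<open>At almost every time in T the slices of u and w agree, so E is the finite
        energy of u and nothing was erased.\<close>
      have "E t = (\<integral>\<^sup>+ x. ennreal ((norm (u x t))\<^sup>2) \<partial>lborel)"
        unfolding E_def using elim t by (intro nn_integral_cong_AE) (auto elim: eventually_mono)
      also have "\<dots> < \<infinity>"
        using elim t by (simp add: square_integrable_def nn_integral_completion)
      finally show "(\<lambda>x. u x t) \<in> borel_measurable lebesgue \<and> (AE x in lborel. u x t = v x t)"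
        using elim t by (simp add: v_def square_integrable_def)
    qed
  qed
  show ?thesis by (rule that[OF v1 v2 v3])
qed

text \<open>Mollification only sees the class of the field modulo null sets, so the two mollified
  fields are the same function and their curls agree at every point.\<close>

lemma vort_cong_AE:
  assumes "continuous_on UNIV \<phi>" "(\<lambda>y. u y t) \<in> borel_measurable lebesgue"
    "(\<lambda>y. v y t) \<in> borel_measurable lebesgue" "AE y in lborel. u y t = v y t"
  shows "vort \<sigma> \<phi> u k x t = vort \<sigma> \<phi> v k x t"
proof -
  have "mollify \<phi> l (\<lambda>y. u y t) = mollify \<phi> l (\<lambda>y. v y t)" for l
  proof
    fix x
    have "continuous_on UNIV (\<lambda>y. \<phi> ((x - y) /\<^sub>R l))"
      by (rule continuous_on_compose2[OF assms(1)]) (auto intro!: continuous_intros)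
    then have "(\<lambda>y. \<phi> ((x - y) /\<^sub>R l)) \<in> borel_measurable lebesgue"
      by (intro measurable_completion) (simp add: borel_measurable_continuous_onI)
    then have [measurable]: "(\<lambda>y. mollifier \<phi> l (x - y)) \<in> borel_measurable lebesgue"
      unfolding mollifier_def by measurable
    note [measurable] = assms(2,3)
    show "mollify \<phi> l (\<lambda>y. u y t) x = mollify \<phi> l (\<lambda>y. v y t) x"
      unfolding mollify_def using AE_completion[OF assms(4)]
      by (intro integral_cong_AE) (auto elim: eventually_mono)
  qed
  then show ?thesis by (simp add: vort_def)
qed

lemma time_slab_subset: "time_slab t0 k \<subseteq> {t0 - 1<..<t0}"
  using power_le_one[OF rad_nonneg rad_le_one, of k 2] by (auto simp: time_slab_def)

text \<open>The null set of bad times is common to all scales and points, and its cylinder in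
  space-time is again null.\<close>

lemma reservoirs_cong_AE:
  assumes eq: "AE t in lborel. t \<in> {t0 - 1<..<t0} \<longrightarrow> (\<forall>k x. vort \<sigma> \<phi> u k x t = vort \<sigma> \<phi> v k x t)"
  shows "mu_far_ann \<Gamma> \<sigma> \<phi> chi x0 t0 u = mu_far_ann \<Gamma> \<sigma> \<phi> chi x0 t0 v"
    and "annular_reservoir \<Gamma> \<sigma> \<phi> x0 t0 u = annular_reservoir \<Gamma> \<sigma> \<phi> x0 t0 v"
    and "core_reservoir \<sigma> \<phi> chi x0 t0 u = core_reservoir \<sigma> \<phi> chi x0 t0 v"
proof -
  have t: "AE t in lebesgue. t \<in> time_slab t0 k \<longrightarrow> (\<forall>x. vort \<sigma> \<phi> u k x t = vort \<sigma> \<phi> v k x t)" for k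
    using AE_completion[OF eq] by (rule eventually_mono) (use time_slab_subset in blast)
  have z: "AE z in lebesgue. snd z \<in> time_slab t0 k \<longrightarrow>
      (\<forall>x. vort \<sigma> \<phi> u k x (snd z) = vort \<sigma> \<phi> v k x (snd z))" for k 
    using t[of k] unfolding AE_completion_iff by (rule AE_snd_lborel)
  \<comment> \<open>Agreement is demanded on the entire time slice, since the shell strain at (x, t)
    reads the vorticity at distant points y.\<close>
  have set_cong: "(\<integral>\<^sup>+ z\<in>A \<times> time_slab t0 k. f z \<partial>lebesgue) = (\<integral>\<^sup>+ z\<in>A \<times> time_slab t0 k. g z \<partial>lebesgue)"
    if "\<And>x t. \<forall>y. vort \<sigma> \<phi> u k y t = vort \<sigma> \<phi> v k y t \<Longrightarrow> f (x, t) = g (x, t)"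
    for f g :: "(real^3) \<times> real \<Rightarrow> ennreal" and A k
    using z[of k]
    by (intro nn_integral_cong_AE) (auto elim!: eventually_mono simp: that split: split_indicator)
  show "mu_far_ann \<Gamma> \<sigma> \<phi> chi x0 t0 u = mu_far_ann \<Gamma> \<sigma> \<phi> chi x0 t0 v"
    unfolding mu_far_ann_def
    by (intro ext arg_cong[where f = "(*) _"] set_cong) (simp add: shell_strain_def)
  show "annular_reservoir \<Gamma> \<sigma> \<phi> x0 t0 u = annular_reservoir \<Gamma> \<sigma> \<phi> x0 t0 v"
    unfolding annular_reservoir_def
    by (intro ext SUP_cong refl arg_cong[where f = "\<lambda>a. epow (_ * a) _"] set_cong) simp
  show "core_reservoir \<sigma> \<phi> chi x0 t0 u = core_reservoir \<sigma> \<phi> chi x0 t0 v"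
    unfolding core_reservoir_def
  proof (intro ext arg_cong[where f = "\<lambda>a. epow a _"] nn_integral_cong_AE)
    fix k
    show "AE t in lebesgue.
        (\<integral>\<^sup>+ x\<in>ball x0 (2 * rad k). ennreal (cutoff chi x0 t0 k x t * (norm (vort \<sigma> \<phi> u k x t))\<^sup>2) \<partial>lebesgue)\<^sup>2
          * indicator (time_slab t0 k) t
      = (\<integral>\<^sup>+ x\<in>ball x0 (2 * rad k). ennreal (cutoff chi x0 t0 k x t * (norm (vort \<sigma> \<phi> v k x t))\<^sup>2) \<partial>lebesgue)\<^sup>2
          * indicator (time_slab t0 k) t"
      using t[of k] by (rule eventually_mono) (auto split: split_indicator)
  qed
qed

lemma mu_far_ann_le:
  assumes "1 < \<Gamma>"
    and W: "\<And>k. (\<lambda>(x, t). vort \<sigma> \<phi> v k x t) \<in> borel_measurable borel"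
    and chi: "continuous_on UNIV chi" "\<And>z. 0 \<le> chi z"
  shows "mu_far_ann \<Gamma> \<sigma> \<phi> chi x0 t0 v k
    \<le> ennreal (annulus_const \<Gamma>) * (\<Sum>j\<in>{0..k}. ennreal ((1/2) ^ (k - j))
      * annular_reservoir \<Gamma> \<sigma> \<phi> x0 t0 v j * core_reservoir \<sigma> \<phi> chi x0 t0 v k)"
proof -
  have "continuous_on UNIV (\<lambda>z. cutoff chi x0 t0 k (fst z) (snd z))"
    unfolding cutoff_def
    by (rule continuous_on_compose2[OF chi(1)])
       (auto intro!: continuous_intros simp: order_less_imp_not_eq2)
  then have c: "(\<lambda>(x, t). cutoff chi x0 t0 k x t) \<in> borel_measurable borel"
    by (simp add: case_prod_beta' borel_measurable_continuous_onI)
  have "mu_far_ann \<Gamma> \<sigma> \<phi> chi x0 t0 v k \<le> ennreal (annulus_const \<Gamma>) *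
    (\<Sum>j\<in>{0..k}. ennreal ((1/2) ^ (k - j))
      * epow (ennreal (1 / rad j) * (\<integral>\<^sup>+ z\<in>fixed_annulus \<Gamma> x0 j \<times> time_slab t0 k.
          (case z of (x, t) \<Rightarrow> ennreal ((norm (vort \<sigma> \<phi> v k x t))\<^sup>2)) \<partial>lebesgue)) (1/2)
      * core_reservoir \<sigma> \<phi> chi x0 t0 v k)"
    unfolding mu_far_ann_def shell_strain_def core_reservoir_def
    using assms by (intro far_annular_estimate W c) (auto simp: cutoff_def)
  \<comment> \<open>For j \<le> k the slab of index k is among those over which the reservoir of
    index j takes its supremum.\<close>
  also have "\<dots> \<le> ennreal (annulus_const \<Gamma>) * (\<Sum>j\<in>{0..k}. ennreal ((1/2) ^ (k - j))
      * annular_reservoir \<Gamma> \<sigma> \<phi> x0 t0 v j * core_reservoir \<sigma> \<phi> chi x0 t0 v k)"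
    unfolding annular_reservoir_def
    by (intro mult_left_mono sum_mono mult_right_mono SUP_upper) auto
  finally show ?thesis .
qed

section \<open>Assembly for Leray-Hopf velocities\<close>

lemma time_interval_sets: "time_interval a b \<in> sets borel"
  unfolding time_interval_def by measurable

text \<open>The representative is chosen for the velocity, so a single field v, with a single
  exceptional set of times, serves every scale k.\<close>

lemma Leray_Hopf_vort_representative:
  assumes "Leray_Hopf a b u0 u" and sub: "{t0 - 1<..<t0} \<subseteq> time_interval a b"
    and \<phi>: "Ck (Suc 0) \<phi>" "\<And>z. 1 < norm z \<Longrightarrow> \<phi> z = 0" and \<sigma>: "0 < \<sigma>"
  obtains v where "\<And>k. (\<lambda>(x, t). vort \<sigma> \<phi> v k x t) \<in> borel_measurable borel"
    and "AE t in lborel. t \<in> {t0 - 1<..<t0} \<longrightarrow> (\<forall>k x. vort \<sigma> \<phi> u k x t = vort \<sigma> \<phi> v k x t)"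
proof -
  obtain G where meas: "(\<lambda>(x, t). u x t) \<in> borel_measurable (lebesgue_on (UNIV \<times> time_interval a b))"
    and "AE t in lebesgue_on (time_interval a b). H1_gradient (\<lambda>x. u x t) (\<lambda>x. G x t)"
    using assms(1) unfolding Leray_Hopf_def by blast
  \<comment> \<open>The clause on the weak gradient contains both measurability and finite energy of
    almost every slice.\<close>
  then have "AE t in lebesgue_on (time_interval a b). square_integrable (\<lambda>x. u x t)"
    by (auto elim: eventually_mono simp: H1_gradient_def)
  from Borel_representative[OF meas time_interval_sets this]
  obtain v where v: "case_prod v \<in> borel_measurable borel"
      "\<And>t. (\<integral>\<^sup>+ x. ennreal ((norm (v x t))\<^sup>2) \<partial>lborel) < \<infinity>"
    and ae: "AE t in lborel. t \<in> time_interval a b \<longrightarrow>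
      (\<lambda>x. u x t) \<in> borel_measurable lebesgue \<and> (AE x in lborel. u x t = v x t)"
    by blast
  have vt: "(\<lambda>x. v x t) \<in> borel_measurable borel" for t
  proof -
    have "(\<lambda>x. case_prod v (x, t)) \<in> borel_measurable borel"
      using v(1) by (rule measurable_compose[rotated]) (intro borel_measurable_continuous_onI continuous_intros)
    then show ?thesis by simp
  qed
  have loc: "locally_integrable (\<lambda>x. v x t)" for t
    using vt v(2) by (rule locally_integrable_square)
  show ?thesis
  proof
    show "(\<lambda>(x, t). vort \<sigma> \<phi> v k x t) \<in> borel_measurable borel" for k
      by (intro borel_measurable_vort \<phi> \<sigma> v(1) loc)
    show "AE t in lborel. t \<in> {t0 - 1<..<t0} \<longrightarrow> (\<forall>k x. vort \<sigma> \<phi> u k x t = vort \<sigma> \<phi> v k x t)"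
      using ae
    proof eventually_elim
      case (elim t)
      show ?case
        using elim sub vt[of t] by (auto intro!: vort_cong_AE continuous_Ck1[OF \<phi>(1)] measurable_completion)
    qed
  qed
qed

theorem theorem8p7:
  fixes \<Gamma> \<sigma> :: real
    and \<phi> :: "real^3 \<Rightarrow> real"
    and chi :: "(real^3) \<times> real \<Rightarrow> real"
  assumes "\<Gamma> > 1" and "0 < \<sigma>" and "\<sigma> < 1"
    and "test_function (ball 0 1) \<phi>" and "\<forall>x. 0 \<le> \<phi> x"
    and "(LINT x|lebesgue. \<phi> x) = 1"
    and "test_function (ball 0 1 \<times> {-1<..<0}) chi" and "\<forall>z. 0 \<le> chi z \<and> chi z \<le> 1"
  shows "\<exists>C0::real. 0 \<le> C0 \<and>
    (\<forall>(a::real) (b::ereal) (u0 :: real^3 \<Rightarrow> real^3) (u :: real^3 \<Rightarrow> real \<Rightarrow> real^3)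
      (x0 :: real^3) (t0::real).
      Leray_Hopf a b u0 u \<and> {t0 - 1<..<t0} \<subseteq> time_interval a b \<longrightarrow>
      (\<forall>k. mu_far_ann \<Gamma> \<sigma> \<phi> chi x0 t0 u k
             \<le> ennreal C0 * (\<Sum>j\<in>{0..k}. ennreal ((1/2) ^ (k - j))
                 * annular_reservoir \<Gamma> \<sigma> \<phi> x0 t0 u j * core_reservoir \<sigma> \<phi> chi x0 t0 u k)) \<and>
      (\<forall>(p::ennreal) (q::ennreal).
         1 \<le> p \<and> 1 \<le> q \<and> 1 / p + 1 / q = 1 \<and>
         lp_norm p (annular_reservoir \<Gamma> \<sigma> \<phi> x0 t0 u) < \<infinity> \<and>
         lp_norm q (core_reservoir \<sigma> \<phi> chi x0 t0 u) < \<infinity> \<longrightarrow>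
         (\<forall>N::nat. (\<Sum>k\<in>{0..N}. mu_far_ann \<Gamma> \<sigma> \<phi> chi x0 t0 u k)
            \<le> 2 * ennreal C0 * lp_norm p (annular_reservoir \<Gamma> \<sigma> \<phi> x0 t0 u)
                * lp_norm q (core_reservoir \<sigma> \<phi> chi x0 t0 u))))"
proof (intro exI[of _ "annulus_const \<Gamma>"] conjI allI impI; (elim conjE)?)
  \<comment> \<open>The witness is fixed before the solution, the base point and the exponents, so
    one constant serves them all.\<close>
  show "0 \<le> annulus_const \<Gamma>"
    using \<open>\<Gamma> > 1\<close> by (simp add: annulus_const_def)
next
  fix a b u0 u x0 t0
  assume LH: "Leray_Hopf a b u0 u" "{t0 - 1<..<t0} \<subseteq> time_interval a b"
  have \<phi>1: "Ck (Suc 0) \<phi>"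
    using assms(4) unfolding test_function_def smooth_def by blast
  have "\<phi> z = 0" if "1 < norm z" for z
  proof (rule ccontr)
    assume "\<phi> z \<noteq> 0"
    then have "z \<in> closure {x. \<phi> x \<noteq> 0}"
      by (intro subsetD[OF closure_subset]) simp
    also have "\<dots> \<subseteq> ball 0 1"
      using assms(4) unfolding test_function_def by (elim conjE)
    finally show False using that by simp
  qed
  note \<phi> = \<phi>1 this
  have "Ck 0 chi"
    using assms(7) unfolding test_function_def smooth_def by blast
  then have chi: "continuous_on UNIV chi" "\<And>z. 0 \<le> chi z"
    using assms(8) by auto
  obtain v where v: "\<And>k. (\<lambda>(x, t). vort \<sigma> \<phi> v k x t) \<in> borel_measurable borel"
    and ae: "AE t in lborel. t \<in> {t0 - 1<..<t0} \<longrightarrow> (\<forall>k x. vort \<sigma> \<phi> u k x t = vort \<sigma> \<phi> v k x t)"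
    using Leray_Hopf_vort_representative[OF LH \<phi> assms(2)] by blast
  \<comment> \<open>This is the bound at a single scale and also the input to the summation. All
    three quantities are rewritten for v, whose vorticity is Borel.\<close>
  show le: "mu_far_ann \<Gamma> \<sigma> \<phi> chi x0 t0 u k
      \<le> ennreal (annulus_const \<Gamma>) * (\<Sum>j\<in>{0..k}. ennreal ((1/2) ^ (k - j))
        * annular_reservoir \<Gamma> \<sigma> \<phi> x0 t0 u j * core_reservoir \<sigma> \<phi> chi x0 t0 u k)" for k
    unfolding reservoirs_cong_AE[OF ae] by (rule mu_far_ann_le[OF assms(1) v chi])
  fix p q :: ennreal and N :: nat
  assume pq: "1 \<le> p" "1 \<le> q" "1 / p + 1 / q = 1"
    "lp_norm p (annular_reservoir \<Gamma> \<sigma> \<phi> x0 t0 u) < \<infinity>"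
    "lp_norm q (core_reservoir \<sigma> \<phi> chi x0 t0 u) < \<infinity>"
  have "(\<Sum>k\<in>{0..N}. mu_far_ann \<Gamma> \<sigma> \<phi> chi x0 t0 u k)
      \<le> ennreal (annulus_const \<Gamma>) * (\<Sum>k\<in>{0..N}. \<Sum>j\<in>{0..k}. ennreal ((1/2) ^ (k - j))
        * annular_reservoir \<Gamma> \<sigma> \<phi> x0 t0 u j * core_reservoir \<sigma> \<phi> chi x0 t0 u k)"
    unfolding sum_distrib_left[of "ennreal (annulus_const \<Gamma>)" _ "{0..N}"] by (intro sum_mono le)
  also have "\<dots> \<le> ennreal (annulus_const \<Gamma>) * (2 * (lp_norm p (annular_reservoir \<Gamma> \<sigma> \<phi> x0 t0 u)
      * lp_norm q (core_reservoir \<sigma> \<phi> chi x0 t0 u)))"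
    by (intro mult_left_mono sum_geometric_convolution_le pq) simp
  finally show "(\<Sum>k\<in>{0..N}. mu_far_ann \<Gamma> \<sigma> \<phi> chi x0 t0 u k)
      \<le> 2 * ennreal (annulus_const \<Gamma>) * lp_norm p (annular_reservoir \<Gamma> \<sigma> \<phi> x0 t0 u)
        * lp_norm q (core_reservoir \<sigma> \<phi> chi x0 t0 u)"
    by (simp add: mult.assoc mult.left_commute)
qed

end
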